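(* Let $R$ be a left Artinian ring and $S\in \mathrm{Den}_l(R,\mathfrak a)$. Then: 1. There exists a nonzero idempotent $e\in R$ such that $S_e:=\{1,e\}\in \mathrm{Den}_l(R,\mathfrak a)$ and the rings $S^{-1}R$ and $S_e^{-1}R$ are $R$-isomorphic. 2. Let $e$ be as in statement 1. Then: (a) If $\mathfrak a=0$ then $e=1$. (b) If $\mathfrak a\neq 0$ then $\mathfrak a=(1-e)R=1_{I(\mathfrak a)}R\not\subseteq \mathrm{rad}(R)$, and the idempotent $e$ is conjugate (by a unit of $R$) to $1_{CI(\mathfrak a)}=1-1_{I(\mathfrak a)}$. (c) With $e_1=e$, $e_2=1-e$ and $R_{ij}=e_iRe_j$, one has $$R=\begin{pmatrix} R_{11}&0\\ R_{21}&R_{22}\end{pmatrix},\qquad \mathfrak a=\begin{pmatrix}0&0\\ R_{21}&R_{22}\end{pmatrix}\qquad\text{and}\qquad S\subseteq \begin{pmatrix} R_{11}^*&0\\ R_{21}&R_{22}\end{pmatrix}.$$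
   Context: Rings are associative with $1\neq 0$; $R^*$ is the group of units and $\mathrm{rad}(R)$ the Jacobson radical of $R$. A multiplicative set $S\subseteq R$ satisfies $1\in S$, $SS\subseteq S$, $0\notin S$. It is a left Ore set if $Sr\cap Rs\neq\emptyset$ for all $r\in R$, $s\in S$; put $\mathrm{ass}(S)=\{r\in R: sr=0 \text{ for some } s\in S\}$, an ideal of $R$ for a left Ore set $S$. A left Ore set $S$ is a left denominator set if $rs=0$ with $r\in R$, $s\in S$ implies $tr=0$ for some $t\in S$. $\mathrm{Den}_l(R)$ is the set of left denominator sets and $\mathrm{Den}_l(R,\mathfrak a)=\{S\in\mathrm{Den}_l(R):\mathrm{ass}(S)=\mathfrak a\}$. $S^{-1}R$ is the left localization of $R$ at $S$; two localizations $S^{-1}R$, $S'^{-1}R$ are $R$-isomorphic if $s^{-1}r\mapsto s^{-1}r$ is a well-defined isomorphism $S^{-1}R\to S'^{-1}R$ (equivalently, there is a ring isomorphism commuting with the canonical maps from $R$). For an idempotent $e$ with $e_1=e$, $e_2=1-e$, the ring $R=\bigoplus_{i,j=1}^2 R_{ij}$, $R_{ij}=e_iRe_j$, is identified with the matrix ring $\begin{pmatrix}R_{11}&R_{12}\\R_{21}&R_{22}\end{pmatrix}$; $R_{11}^*$ is the group of units of the ring $R_{11}=eRe$ (with identity $e$). For a left Artinian ring $R$ write $\overline R:=R/\mathrm{rad}(R)=\prod_{i=1}^s\overline R_i$, a product of simple Artinian rings, with $\overline 1_i$ the identity of $\overline R_i$. Fix a decomposition $1=\sum_{i=1}^s1_i$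 into orthogonal idempotents of $R$ with $1_i+\mathrm{rad}(R)=\overline 1_i$ (such a decomposition exists and is unique up to simultaneous conjugation). For $I\subseteq\{1,\dots,s\}$ put $1_I=\sum_{i\in I}1_i$ and $\overline 1_I=\sum_{i\in I}\overline 1_i$. For an ideal $\mathfrak a\not\subseteq\mathrm{rad}(R)$, $I(\mathfrak a)$ denotes the unique non-empty subset of $\{1,\dots,s\}$ with $(\mathfrak a+\mathrm{rad}(R))/\mathrm{rad}(R)=\overline R\,\overline 1_{I(\mathfrak a)}$, and $CI(\mathfrak a)$ is the complement of $I(\mathfrak a)$ in $\{1,\dots,s\}$. *)

theory Defs
  imports "HOL-Algebra.Chinese_Remainder"
begin

section \<open>Left Artinian rings and the Jacobson radical\<close>

text \<open>Rings are the (not necessarily commutative) rings of the locale \<^locale>\<open>ring\<close>;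
  the condition \<open>\<one> \<noteq> \<zero>\<close> is imposed explicitly.\<close>

definition left_ideal :: "'a set \<Rightarrow> ('a, 'm) ring_scheme \<Rightarrow> bool" where
  "left_ideal I R \<longleftrightarrow>
     additive_subgroup I R \<and> (\<forall>x\<in>carrier R. \<forall>a\<in>I. x \<otimes>\<^bsub>R\<^esub> a \<in> I)"

definition maximal_left_ideal :: "'a set \<Rightarrow> ('a, 'm) ring_scheme \<Rightarrow> bool" where
  "maximal_left_ideal M R \<longleftrightarrow>
     left_ideal M R \<and> M \<noteq> carrier R \<and>
     (\<forall>I. left_ideal I R \<and> M \<subseteq> I \<longrightarrow> I = M \<or> I = carrier R)"

definition jacobson_radical :: "('a, 'm) ring_scheme \<Rightarrow> 'a set" where
  "jacobson_radical R = carrier R \<inter> \<Inter>{M. maximal_left_ideal M R}"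

definition left_artinian_ring :: "('a, 'm) ring_scheme \<Rightarrow> bool" where
  "left_artinian_ring R \<longleftrightarrow>
     ring R \<and> \<one>\<^bsub>R\<^esub> \<noteq> \<zero>\<^bsub>R\<^esub> \<and>
     (\<forall>I :: nat \<Rightarrow> 'a set.
        (\<forall>n. left_ideal (I n) R) \<and> (\<forall>n. I (Suc n) \<subseteq> I n)
          \<longrightarrow> (\<exists>N. \<forall>n\<ge>N. I n = I N))"

definition simple_ring :: "('a, 'm) ring_scheme \<Rightarrow> bool" where
  "simple_ring R \<longleftrightarrow>
     ring R \<and> \<one>\<^bsub>R\<^esub> \<noteq> \<zero>\<^bsub>R\<^esub> \<and>
     (\<forall>I. ideal I R \<longrightarrow> I = {\<zero>\<^bsub>R\<^esub>} \<or> I = carrier R)"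

section \<open>Left denominator sets\<close>

definition multiplicative_set :: "('a, 'm) ring_scheme \<Rightarrow> 'a set \<Rightarrow> bool" where
  "multiplicative_set R S \<longleftrightarrow> submonoid S R \<and> \<zero>\<^bsub>R\<^esub> \<notin> S"

definition left_ore_set :: "('a, 'm) ring_scheme \<Rightarrow> 'a set \<Rightarrow> bool" where
  "left_ore_set R S \<longleftrightarrow>
     multiplicative_set R S \<and>
     (\<forall>r\<in>carrier R. \<forall>s\<in>S.
        {t \<otimes>\<^bsub>R\<^esub> r | t. t \<in> S} \<inter> {x \<otimes>\<^bsub>R\<^esub> s | x. x \<in> carrier R} \<noteq> {})"

definition ass :: "('a, 'm) ring_scheme \<Rightarrow> 'a set \<Rightarrow> 'a set" where
  "ass R S = {r \<in> carrier R. \<exists>s\<in>S. s \<otimes>\<^bsub>R\<^esub> r = \<zero>\<^bsub>R\<^esub>}"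

definition left_denominator_set :: "('a, 'm) ring_scheme \<Rightarrow> 'a set \<Rightarrow> bool" where
  "left_denominator_set R S \<longleftrightarrow>
     left_ore_set R S \<and>
     (\<forall>r\<in>carrier R. \<forall>s\<in>S. r \<otimes>\<^bsub>R\<^esub> s = \<zero>\<^bsub>R\<^esub> \<longrightarrow> (\<exists>t\<in>S. t \<otimes>\<^bsub>R\<^esub> r = \<zero>\<^bsub>R\<^esub>))"

definition Den_l :: "('a, 'm) ring_scheme \<Rightarrow> 'a set \<Rightarrow> 'a set set" where
  "Den_l R \<aa> = {S. left_denominator_set R S \<and> ass R S = \<aa>}"

section \<open>The left localization\<close>

text \<open>The pair \<open>(s, r)\<close> represents the left fraction \<open>s\<^sup>-\<^sup>1 r\<close>. Two pairs represent the same
  fraction iff they can be expanded on the left to a common denominator in \<open>S\<close> with equal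
  numerators. For a left denominator set this is an equivalence relation, and the unions
  defining sum and product below range over copies of one and the same class (the usual
  rendering of an operation that does not depend on the choice of representatives).\<close>

definition fraction_rel :: "('a, 'm) ring_scheme \<Rightarrow> 'a set \<Rightarrow> (('a \<times> 'a) \<times> ('a \<times> 'a)) set" where
  "fraction_rel R S =
     {((s, r), (s', r')) | s r s' r'.
        s \<in> S \<and> s' \<in> S \<and> r \<in> carrier R \<and> r' \<in> carrier R \<and>
        (\<exists>c\<in>carrier R. \<exists>d\<in>carrier R.
           c \<otimes>\<^bsub>R\<^esub> s = d \<otimes>\<^bsub>R\<^esub> s' \<and> c \<otimes>\<^bsub>R\<^esub> s \<in> S \<and> c \<otimes>\<^bsub>R\<^esub> r = d \<otimes>\<^bsub>R\<^esub> r')}"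

definition fraction :: "('a, 'm) ring_scheme \<Rightarrow> 'a set \<Rightarrow> 'a \<Rightarrow> 'a \<Rightarrow> ('a \<times> 'a) set" where
  "fraction R S s r = fraction_rel R S `` {(s, r)}"

text \<open>Sum: \<open>s\<^sup>-\<^sup>1 r + s'\<^sup>-\<^sup>1 r' = (c s)\<^sup>-\<^sup>1 (c r + d r')\<close> whenever \<open>c s = d s' \<in> S\<close>.
  Product: \<open>s\<^sup>-\<^sup>1 r \<cdot> s'\<^sup>-\<^sup>1 r' = (t s)\<^sup>-\<^sup>1 (c r')\<close> whenever \<open>t r = c s'\<close> with \<open>t \<in> S\<close>.\<close>

definition left_localization :: "('a, 'm) ring_scheme \<Rightarrow> 'a set \<Rightarrow> ('a \<times> 'a) set ring" where
  "left_localization R S =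
     \<lparr>carrier = (S \<times> carrier R) // fraction_rel R S,
      mult = (\<lambda>P Q. \<Union>{fraction R S (t \<otimes>\<^bsub>R\<^esub> s) (c \<otimes>\<^bsub>R\<^esub> r') | s r s' r' t c.
                 (s, r) \<in> P \<and> (s', r') \<in> Q \<and> t \<in> S \<and> c \<in> carrier R \<and>
                 t \<otimes>\<^bsub>R\<^esub> r = c \<otimes>\<^bsub>R\<^esub> s'}),
      one = fraction R S \<one>\<^bsub>R\<^esub> \<one>\<^bsub>R\<^esub>,
      zero = fraction R S \<one>\<^bsub>R\<^esub> \<zero>\<^bsub>R\<^esub>,
      add = (\<lambda>P Q. \<Union>{fraction R S (c \<otimes>\<^bsub>R\<^esub> s) (c \<otimes>\<^bsub>R\<^esub> r \<oplus>\<^bsub>R\<^esub> d \<otimes>\<^bsub>R\<^esub> r') | s r s' r' c d.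
                 (s, r) \<in> P \<and> (s', r') \<in> Q \<and> c \<in> carrier R \<and> d \<in> carrier R \<and>
                 c \<otimes>\<^bsub>R\<^esub> s = d \<otimes>\<^bsub>R\<^esub> s' \<and> c \<otimes>\<^bsub>R\<^esub> s \<in> S})\<rparr>"

definition R_isomorphic_localizations :: "('a, 'm) ring_scheme \<Rightarrow> 'a set \<Rightarrow> 'a set \<Rightarrow> bool" where
  "R_isomorphic_localizations R S S' \<longleftrightarrow>
     (\<exists>f \<in> ring_iso (left_localization R S) (left_localization R S').
        \<forall>r\<in>carrier R. f (fraction R S \<one>\<^bsub>R\<^esub> r) = fraction R S' \<one>\<^bsub>R\<^esub> r)"

section \<open>Idempotents and Peirce components\<close>

definition idempotent :: "('a, 'm) ring_scheme \<Rightarrow> 'a \<Rightarrow> bool" where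
  "idempotent R e \<longleftrightarrow> e \<in> carrier R \<and> e \<otimes>\<^bsub>R\<^esub> e = e"

definition peirce :: "('a, 'm) ring_scheme \<Rightarrow> 'a \<Rightarrow> 'a \<Rightarrow> 'a set" where
  "peirce R e f = {e \<otimes>\<^bsub>R\<^esub> x \<otimes>\<^bsub>R\<^esub> f | x. x \<in> carrier R}"

definition corner_ring :: "('a, 'm) ring_scheme \<Rightarrow> 'a \<Rightarrow> ('a, 'm) ring_scheme" where
  "corner_ring R e = R\<lparr>carrier := peirce R e e, one := e\<rparr>"

text \<open>The elements of \<open>R\<close> whose matrix with respect to \<open>e\<^sub>1 = e\<close>, \<open>e\<^sub>2 = 1 - e\<close> has its entries
  in \<open>A\<close>, \<open>B\<close> (first row) and \<open>C\<close>, \<open>D\<close> (second row).\<close>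

definition matrix_set ::
  "('a, 'm) ring_scheme \<Rightarrow> 'a \<Rightarrow> 'a set \<Rightarrow> 'a set \<Rightarrow> 'a set \<Rightarrow> 'a set \<Rightarrow> 'a set" where
  "matrix_set R e A B C D =
     (let e' = \<one>\<^bsub>R\<^esub> \<ominus>\<^bsub>R\<^esub> e in
      {x \<in> carrier R.
         e \<otimes>\<^bsub>R\<^esub> x \<otimes>\<^bsub>R\<^esub> e \<in> A \<and> e \<otimes>\<^bsub>R\<^esub> x \<otimes>\<^bsub>R\<^esub> e' \<in> B \<and>
         e' \<otimes>\<^bsub>R\<^esub> x \<otimes>\<^bsub>R\<^esub> e \<in> C \<and> e' \<otimes>\<^bsub>R\<^esub> x \<otimes>\<^bsub>R\<^esub> e' \<in> D})"

definition right_multiples :: "('a, 'm) ring_scheme \<Rightarrow> 'a \<Rightarrow> 'a set" where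
  "right_multiples R a = {a \<otimes>\<^bsub>R\<^esub> x | x. x \<in> carrier R}"

definition left_multiples :: "('a, 'm) ring_scheme \<Rightarrow> 'a \<Rightarrow> 'a set" where
  "left_multiples R a = {x \<otimes>\<^bsub>R\<^esub> a | x. x \<in> carrier R}"

definition conjugate :: "('a, 'm) ring_scheme \<Rightarrow> 'a \<Rightarrow> 'a \<Rightarrow> bool" where
  "conjugate R x y \<longleftrightarrow> (\<exists>v\<in>Units R. x = v \<otimes>\<^bsub>R\<^esub> y \<otimes>\<^bsub>R\<^esub> inv\<^bsub>R\<^esub> v)"

section \<open>Semisimple quotient and lifted idempotents\<close>

text \<open>\<open>c 1, \<dots>, c n\<close> are the identities of the factors in a decomposition
  \<open>Q = \<Prod>\<^sub>i Q\<^sub>i\<close> into simple Artinian rings, the factor \<open>Q\<^sub>i\<close> being regarded as the subset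
  \<open>Q (c i)\<close> of \<open>Q\<close> with identity \<open>c i\<close>: each \<open>Q\<^sub>i\<close> is a simple Artinian ring and
  \<open>q \<mapsto> (q (c 1), \<dots>, q (c n))\<close> is a ring isomorphism onto the product.\<close>

definition simple_factors :: "('a, 'm) ring_scheme \<Rightarrow> nat \<Rightarrow> (nat \<Rightarrow> 'a) \<Rightarrow> bool" where
  "simple_factors Q n c \<longleftrightarrow>
     (let factor = (\<lambda>i. Q\<lparr>carrier := left_multiples Q (c i), one := c i\<rparr>) in
      (\<forall>i\<in>{1..n}. c i \<in> carrier Q \<and> simple_ring (factor i) \<and> left_artinian_ring (factor i)) \<and>
      (\<lambda>q. map (\<lambda>i. q \<otimes>\<^bsub>Q\<^esub> c i) [1..<Suc n])
        \<in> ring_iso Q (RDirProd_list (map factor [1..<Suc n])))"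

abbreviation semisimple_quotient :: "('a, 'm) ring_scheme \<Rightarrow> 'a set ring" where
  "semisimple_quotient R \<equiv> R Quot (jacobson_radical R)"

abbreviation residue :: "('a, 'm) ring_scheme \<Rightarrow> 'a \<Rightarrow> 'a set" where
  "residue R x \<equiv> jacobson_radical R +>\<^bsub>R\<^esub> x"

definition lifted_decomposition :: "('a, 'm) ring_scheme \<Rightarrow> nat \<Rightarrow> (nat \<Rightarrow> 'a) \<Rightarrow> bool" where
  "lifted_decomposition R n u \<longleftrightarrow>
     (\<forall>i\<in>{1..n}. idempotent R (u i)) \<and>
     (\<forall>i\<in>{1..n}. \<forall>j\<in>{1..n}. i \<noteq> j \<longrightarrow> u i \<otimes>\<^bsub>R\<^esub> u j = \<zero>\<^bsub>R\<^esub>) \<and>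
     finsum R u {1..n} = \<one>\<^bsub>R\<^esub> \<and>
     simple_factors (semisimple_quotient R) n (\<lambda>i. residue R (u i))"

text \<open>The index set \<open>I(\<aa>)\<close>; it is only meaningful for ideals \<open>\<aa>\<close> not contained in the radical.\<close>

definition ideal_index ::
  "('a, 'm) ring_scheme \<Rightarrow> nat \<Rightarrow> (nat \<Rightarrow> 'a) \<Rightarrow> 'a set \<Rightarrow> nat set" where
  "ideal_index R n u \<aa> =
     (THE I. I \<subseteq> {1..n} \<and> I \<noteq> {} \<and>
        residue R ` (\<aa> <+>\<^bsub>R\<^esub> jacobson_radical R) =
          left_multiples (semisimple_quotient R)
            (finsum (semisimple_quotient R) (\<lambda>i. residue R (u i)) I))"

definition ideal_coindex ::
  "('a, 'm) ring_scheme \<Rightarrow> nat \<Rightarrow> (nat \<Rightarrow> 'a) \<Rightarrow> 'a set \<Rightarrow> nat set" where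
  "ideal_coindex R n u \<aa> = {1..n} - ideal_index R n u \<aa>"

section \<open>Idempotents computing a localization\<close>

definition localizing_idempotent ::
  "('a, 'm) ring_scheme \<Rightarrow> 'a set \<Rightarrow> 'a set \<Rightarrow> 'a \<Rightarrow> bool" where
  "localizing_idempotent R S \<aa> e \<longleftrightarrow>
     idempotent R e \<and> e \<noteq> \<zero>\<^bsub>R\<^esub> \<and> {\<one>\<^bsub>R\<^esub>, e} \<in> Den_l R \<aa> \<and>
     R_isomorphic_localizations R S {\<one>\<^bsub>R\<^esub>, e}"

end

theory Submission
  imports Defs
begin

text \<open>Elements of \<open>S\<close> become cancellable modulo \<open>\<aa> = ass(S)\<close>, and a cancellable element of the left
  Artinian ring \<open>R/\<aa>\<close> is a unit (\<open>left_artinian_unit\<close>, \<open>unit_mod_ass\<close>). Hence \<open>R/\<aa>\<close> is already the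
  localization \<open>S\<^sup>-\<^sup>1 R\<close> (\<open>localization_iso\<close>), and any two left denominator sets with the same
  associated ideal have \<open>R\<close>-isomorphic localizations (\<open>R_isomorphic_if_same_ass\<close>). It remains to
  find an idempotent \<open>e\<close> such that \<open>{1, e}\<close> is a left denominator set with associated ideal \<open>\<aa>\<close>.

  By the descending chain condition on left annihilators some single \<open>s \<in> S\<close> annihilates \<open>\<aa>\<close>
  (\<open>common_annihilator\<close>). Choose \<open>r\<close> with \<open>r s = 1 - a\<close>, \<open>a \<in> \<aa>\<close>. Then \<open>(1 - a) \<aa> = 0\<close>, that is,
  \<open>a\<close> is a left identity of \<open>\<aa>\<close>; so \<open>e = 1 - a\<close> is an idempotent with annihilated set \<open>\<aa>\<close>
  (\<open>exists_annihilating_idempotent\<close>).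

  Conversely, for every idempotent \<open>e\<close> with \<open>{1, e}\<close> in \<open>Den\<^sub>l(R, \<aa>)\<close> the ideal \<open>\<aa>\<close> is
  \<open>{r. e r = 0} = (1 - e) R\<close>. As it is two-sided, \<open>e R (1 - e) = 0\<close>, which gives the triangular shape;
  and \<open>s \<in> S\<close> has an inverse modulo \<open>\<aa>\<close>, whose corner is an inverse of \<open>e s e\<close> in \<open>e R e\<close>.

  For the comparison with the lifted idempotents, the image of \<open>\<aa>\<close> in the product \<open>R/rad(R)\<close> of
  simple rings is an ideal, hence generated as a left ideal by the idempotent \<open>c\<close> belonging to \<open>I(\<aa>)\<close>
  (\<open>ideal_eq_multiples\<close>). The residue of \<open>1 - e\<close> is a left identity of the same ideal, and this
  forces it to be \<open>c\<close> (\<open>residue_ideal_index_sum\<close>). Idempotents with the same residue modulo the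
  radical are conjugate because \<open>1 + rad(R)\<close> consists of units (\<open>conjugate_if_idempotents_cong\<close>), and
  conjugation does not change the two-sided ideal \<open>(1 - e) R\<close>.\<close>

section \<open>Left ideals and the Jacobson radical\<close>

context ring
begin

lemma left_idealI:
  assumes "I \<subseteq> carrier R" "\<zero> \<in> I"
    and add: "\<And>a b. a \<in> I \<Longrightarrow> b \<in> I \<Longrightarrow> a \<oplus> b \<in> I"
    and mult: "\<And>x a. x \<in> carrier R \<Longrightarrow> a \<in> I \<Longrightarrow> x \<otimes> a \<in> I"
  shows "left_ideal I R"
proof -
  have "\<ominus> a \<in> I" if "a \<in> I" for a
  proof -
    have "\<ominus> a = (\<ominus> \<one>) \<otimes> a"
      using that assms(1) by (auto simp: l_minus)
    then show ?thesis
      using mult[OF _ that, of "\<ominus> \<one>"] by simp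
  qed
  then have "subgroup I (add_monoid R)"
    using assms by (intro add.subgroupI) (auto simp: a_inv_def)
  then show ?thesis
    using mult by (auto simp: left_ideal_def additive_subgroup_def)
qed

lemma left_idealD:
  assumes "left_ideal I R"
  shows "I \<subseteq> carrier R" "\<zero> \<in> I"
    and "\<And>a b. a \<in> I \<Longrightarrow> b \<in> I \<Longrightarrow> a \<oplus> b \<in> I"
    and "\<And>x a. x \<in> carrier R \<Longrightarrow> a \<in> I \<Longrightarrow> x \<otimes> a \<in> I"
    and "\<And>a. a \<in> I \<Longrightarrow> \<ominus> a \<in> I"
    and "\<And>a b. a \<in> I \<Longrightarrow> b \<in> I \<Longrightarrow> a \<ominus> b \<in> I"
proof -
  interpret additive_subgroup I R
    using assms by (simp add: left_ideal_def)
  show "I \<subseteq> carrier R" "\<zero> \<in> I"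
    "\<And>a b. a \<in> I \<Longrightarrow> b \<in> I \<Longrightarrow> a \<oplus> b \<in> I"
    using a_subset by auto
  show "\<And>x a. x \<in> carrier R \<Longrightarrow> a \<in> I \<Longrightarrow> x \<otimes> a \<in> I"
    using assms by (simp add: left_ideal_def)
  show neg: "\<ominus> a \<in> I" if "a \<in> I" for a
    using that abelian_group_axioms
    by (simp add: additive_subgroup.a_inv_closed additive_subgroup_axioms)
  show "\<And>a b. a \<in> I \<Longrightarrow> b \<in> I \<Longrightarrow> a \<ominus> b \<in> I"
    using neg by (simp add: a_minus_def)
qed

lemma ideal_if_left_ideal:
  assumes "left_ideal I R" and "\<And>a x. a \<in> I \<Longrightarrow> x \<in> carrier R \<Longrightarrow> a \<otimes> x \<in> I"
  shows "ideal I R"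
  using assms by (intro idealI[OF ring_axioms]) (auto simp: left_ideal_def additive_subgroup_def)

lemma left_ideal_proper_iff:
  assumes "left_ideal I R"
  shows "I \<noteq> carrier R \<longleftrightarrow> \<one> \<notin> I"
  using left_idealD(1,4)[OF assms] by (metis one_closed r_one subsetI subset_antisym)

lemma left_ideal_multiples:
  assumes "y \<in> carrier R"
  shows "left_ideal {x \<otimes> y | x. x \<in> carrier R} R"
proof (rule left_idealI)
  show "\<zero> \<in> {x \<otimes> y | x. x \<in> carrier R}"
    using assms by (auto intro!: exI[of _ \<zero>])
next
  fix a b
  assume "a \<in> {x \<otimes> y | x. x \<in> carrier R}" "b \<in> {x \<otimes> y | x. x \<in> carrier R}"
  then obtain x x' where "a = x \<otimes> y" "b = x' \<otimes> y" "x \<in> carrier R" "x' \<in> carrier R"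
    by auto
  then have "a \<oplus> b = (x \<oplus> x') \<otimes> y" "x \<oplus> x' \<in> carrier R"
    using assms by (auto simp: l_distr)
  then show "a \<oplus> b \<in> {x \<otimes> y | x. x \<in> carrier R}"
    by blast
next
  fix r a
  assume r: "r \<in> carrier R" and "a \<in> {x \<otimes> y | x. x \<in> carrier R}"
  then obtain x where "a = x \<otimes> y" "x \<in> carrier R"
    by auto
  then have "r \<otimes> a = (r \<otimes> x) \<otimes> y" "r \<otimes> x \<in> carrier R"
    using assms r by (auto simp: m_assoc)
  then show "r \<otimes> a \<in> {x \<otimes> y | x. x \<in> carrier R}"
    by blast
qed (use assms in auto)

lemma left_ideal_sum:
  assumes I: "left_ideal I R" and J: "left_ideal J R"
  shows "left_ideal {i \<oplus> j | i j. i \<in> I \<and> j \<in> J} R"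
proof (rule left_idealI)
  note D = left_idealD[OF I] left_idealD[OF J]
  show "{i \<oplus> j | i j. i \<in> I \<and> j \<in> J} \<subseteq> carrier R"
    using D by auto
  show "\<zero> \<in> {i \<oplus> j | i j. i \<in> I \<and> j \<in> J}"
    using D(2) D(8) by (auto intro!: exI[of _ \<zero>])
  fix a assume "a \<in> {i \<oplus> j | i j. i \<in> I \<and> j \<in> J}"
  then obtain i j where a: "a = i \<oplus> j" "i \<in> I" "j \<in> J" by auto
  have ij: "i \<in> carrier R" "j \<in> carrier R" using a D by auto
  {
    fix b assume "b \<in> {i \<oplus> j | i j. i \<in> I \<and> j \<in> J}"
    then obtain i' j' where b: "b = i' \<oplus> j'" "i' \<in> I" "j' \<in> J" by auto
    have ij': "i' \<in> carrier R" "j' \<in> carrier R" using b D by auto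
    have "a \<oplus> b = (i \<oplus> i') \<oplus> (j \<oplus> j')"
      using a b ij ij' by (simp add: a_ac)
    then show "a \<oplus> b \<in> {i \<oplus> j | i j. i \<in> I \<and> j \<in> J}"
      using D(3)[OF a(2) b(2)] D(9)[OF a(3) b(3)] by blast
  }
  fix x assume x: "x \<in> carrier R"
  then have "x \<otimes> a = x \<otimes> i \<oplus> x \<otimes> j"
    using a ij by (simp add: r_distr)
  then show "x \<otimes> a \<in> {i \<oplus> j | i j. i \<in> I \<and> j \<in> J}"
    using D(4)[OF x a(2)] D(10)[OF x a(3)] by blast
qed

lemma maximal_left_ideal_complement:
  assumes M: "maximal_left_ideal M R" and y: "y \<in> carrier R" "y \<notin> M" and r: "r \<in> carrier R"
  shows "\<exists>x\<in>carrier R. r \<ominus> x \<otimes> y \<in> M"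
proof -
  have MI: "left_ideal M R"
    using M by (simp add: maximal_left_ideal_def)
  note D = left_idealD[OF MI]
  let ?J = "{m \<oplus> z | m z. m \<in> M \<and> z \<in> {x \<otimes> y | x. x \<in> carrier R}}"
  have J: "left_ideal ?J R"
    using left_ideal_sum[OF MI left_ideal_multiples[OF y(1)]] .
  have "M \<subseteq> ?J"
  proof
    fix m assume "m \<in> M"
    moreover have "m = m \<oplus> \<zero> \<otimes> y"
      using D(1) \<open>m \<in> M\<close> y by auto
    ultimately show "m \<in> ?J" by blast
  qed
  moreover have "y \<in> ?J"
  proof -
    have "y = \<zero> \<oplus> \<one> \<otimes> y" using y by simp
    then show ?thesis using D(2) by blast
  qed
  ultimately have "M \<subseteq> ?J" "?J \<noteq> M"
    using y(2) by blast+
  moreover have "?J = M \<or> ?J = carrier R"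
    using M J \<open>M \<subseteq> ?J\<close> unfolding maximal_left_ideal_def by blast
  ultimately have "?J = carrier R"
    by blast
  then obtain m x where mx: "m \<in> M" "x \<in> carrier R" "r = m \<oplus> x \<otimes> y"
    using r by blast
  then have "r \<ominus> x \<otimes> y = m"
    using subsetD[OF D(1) mx(1)] y by (simp add: a_minus_def a_assoc r_neg)
  then show ?thesis using mx by blast
qed

text \<open>Multiplication by \<open>r \<notin> M\<close> induces a surjection from \<open>R\<close> onto the simple module \<open>R/M\<close>, and
  the left ideal of all \<open>x\<close> with \<open>x r \<in> M\<close> is its kernel.\<close>

lemma maximal_left_ideal_colon:
  assumes M: "maximal_left_ideal M R" and r: "r \<in> carrier R" "r \<notin> M"
  shows "maximal_left_ideal {x \<in> carrier R. x \<otimes> r \<in> M} R" (is "maximal_left_ideal ?C R")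
  unfolding maximal_left_ideal_def
proof (intro conjI allI impI)
  have MI: "left_ideal M R"
    using M by (simp add: maximal_left_ideal_def)
  note D = left_idealD[OF MI]
  show C: "left_ideal ?C R"
    using r D by (intro left_idealI) (auto simp: l_distr m_assoc)
  show "?C \<noteq> carrier R"
    using r by (auto simp: left_ideal_proper_iff[OF C])
  fix I assume I: "left_ideal I R \<and> ?C \<subseteq> I"
  note DI = left_idealD[OF conjunct1[OF I]]
  show "I = ?C \<or> I = carrier R"
  proof (rule ccontr)
    assume *: "\<not> (I = ?C \<or> I = carrier R)"
    then obtain y where y: "y \<in> I" "y \<notin> ?C" using I by blast
    have yc: "y \<in> carrier R" "y \<otimes> r \<notin> M" using y DI(1) by auto
    obtain z where z: "z \<in> carrier R" "r \<ominus> z \<otimes> (y \<otimes> r) \<in> M"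
      using maximal_left_ideal_complement[OF M _ yc(2) r(1)] yc r by auto
    have "(\<one> \<ominus> z \<otimes> y) \<otimes> r = r \<ominus> z \<otimes> (y \<otimes> r)"
      using z yc r by (simp add: a_minus_def l_distr l_minus m_assoc)
    then have "\<one> \<ominus> z \<otimes> y \<in> ?C"
      using z yc by simp
    then have "\<one> \<ominus> z \<otimes> y \<in> I"
      using I by blast
    then have "(\<one> \<ominus> z \<otimes> y) \<oplus> z \<otimes> y \<in> I"
      using DI(3,4) y z by blast
    then have "\<one> \<in> I"
      using z yc by (simp add: a_minus_def a_assoc l_neg)
    then show False
      using * left_ideal_proper_iff I by blast
  qed
qed

text \<open>Only closure under right multiplication by \<open>x\<close> is at stake. If \<open>x \<notin> M\<close>, an element of the
  radical lies in the maximal left ideal \<open>{y. y x \<in> M}\<close>, so its product with \<open>x\<close> lies in \<open>M\<close>.\<close>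

lemma ideal_jacobson_radical: "ideal (jacobson_radical R) R"
proof (rule ideal_if_left_ideal)
  let ?J = "jacobson_radical R"
  have D: "left_ideal M R" if "maximal_left_ideal M R" for M
    using that by (simp add: maximal_left_ideal_def)
  show "left_ideal ?J R"
    unfolding jacobson_radical_def
    by (intro left_idealI) (auto intro: left_idealD(2-4)[OF D])
  show "a \<otimes> x \<in> ?J" if a: "a \<in> ?J" and x: "x \<in> carrier R" for a x
    unfolding jacobson_radical_def
  proof (clarsimp, intro conjI allI impI)
    show "a \<otimes> x \<in> carrier R" using a x by (simp add: jacobson_radical_def)
    fix M assume M: "maximal_left_ideal M R"
    show "a \<otimes> x \<in> M"
    proof (cases "x \<in> M")
      case True
      then show ?thesis using left_idealD(4)[OF D[OF M]] a by (simp add: jacobson_radical_def)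
    next
      case False
      then show ?thesis
        using maximal_left_ideal_colon[OF M x] a by (auto simp: jacobson_radical_def)
    qed
  qed
qed

lemma exists_maximal_left_ideal:
  assumes I: "left_ideal I R" and "\<one> \<notin> I"
  shows "\<exists>M. maximal_left_ideal M R \<and> I \<subseteq> M"
proof -
  let ?A = "{J. left_ideal J R \<and> I \<subseteq> J \<and> \<one> \<notin> J}"
  have "\<exists>M\<in>?A. \<forall>X\<in>?A. M \<subseteq> X \<longrightarrow> X = M"
  proof (rule subset_Zorn_nonempty)
    show "?A \<noteq> {}" using assms by blast
    fix C assume C: "C \<noteq> {}" "subset.chain ?A C"
    then have CA: "C \<subseteq> ?A" and lin: "\<And>X Y. X \<in> C \<Longrightarrow> Y \<in> C \<Longrightarrow> X \<subseteq> Y \<or> Y \<subseteq> X"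
      by (auto simp: subset_chain_def)
    have "left_ideal (\<Union>C) R"
    proof (rule left_idealI)
      show "\<Union>C \<subseteq> carrier R" using CA left_idealD(1) by blast
      show "\<zero> \<in> \<Union>C" using CA C left_idealD(2) by blast
      show "x \<otimes> a \<in> \<Union>C" if "x \<in> carrier R" "a \<in> \<Union>C" for x a
        using that CA left_idealD(4) by blast
      fix a b assume "a \<in> \<Union>C" "b \<in> \<Union>C"
      then obtain X Y where XY: "X \<in> C" "Y \<in> C" "a \<in> X" "b \<in> Y" by blast
      show "a \<oplus> b \<in> \<Union>C"
      proof (cases "X \<subseteq> Y")
        case True
        then have "a \<oplus> b \<in> Y" using XY CA left_idealD(3)[of Y a b] by blast
        then show ?thesis using XY by blast
      next
        case False
        then have "a \<oplus> b \<in> X" using XY CA left_idealD(3)[of X a b] lin[OF XY(1,2)] by blast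
        then show ?thesis using XY by blast
      qed
    qed
    then show "\<Union>C \<in> ?A" using CA C by blast
  qed
  then obtain M where MA: "M \<in> ?A" and top: "\<forall>X\<in>?A. M \<subseteq> X \<longrightarrow> X = M"
    by (rule bexE)
  then have M: "left_ideal M R" "I \<subseteq> M" "\<one> \<notin> M"
    by simp_all
  have max: "X = M" if "left_ideal X R" "I \<subseteq> X" "\<one> \<notin> X" "M \<subseteq> X" for X
    using top that by simp
  have "maximal_left_ideal M R"
    unfolding maximal_left_ideal_def
  proof (intro conjI allI impI)
    show "left_ideal M R" "M \<noteq> carrier R"
      using M by (auto simp: left_ideal_proper_iff)
    fix X assume X: "left_ideal X R \<and> M \<subseteq> X"
    then show "X = M \<or> X = carrier R"
      using max[of X] left_ideal_proper_iff[of X] M(2) by blast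
  qed
  then show ?thesis using M by blast
qed

lemma left_inverse_if_cong_one:
  assumes x: "x \<in> carrier R" "x \<ominus> \<one> \<in> jacobson_radical R"
  shows "\<exists>y\<in>carrier R. y \<otimes> x = \<one>"
proof (rule ccontr)
  assume "\<not> (\<exists>y\<in>carrier R. y \<otimes> x = \<one>)"
  then have "\<one> \<notin> {y \<otimes> x | y. y \<in> carrier R}" by force
  then obtain M where M: "maximal_left_ideal M R" "{y \<otimes> x | y. y \<in> carrier R} \<subseteq> M"
    using exists_maximal_left_ideal[OF left_ideal_multiples[OF x(1)]] by blast
  then have MI: "left_ideal M R" "M \<noteq> carrier R"
    by (auto simp: maximal_left_ideal_def)
  have "\<one> \<otimes> x \<in> M" using M(2) by blast
  moreover have "x \<ominus> \<one> \<in> M" using x(2) M(1) by (auto simp: jacobson_radical_def)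
  ultimately have "\<one> \<otimes> x \<ominus> (x \<ominus> \<one>) \<in> M" using left_idealD(6)[OF MI(1)] by blast
  moreover have "\<one> \<otimes> x \<ominus> (x \<ominus> \<one>) = \<one>"
    using x(1) by (simp add: a_minus_def minus_add r_neg1 r_neg flip: a_assoc)
  ultimately show False using left_ideal_proper_iff[OF MI(1)] MI(2) by simp
qed

text \<open>A left inverse \<open>y\<close> of \<open>x\<close> is again congruent to \<open>1\<close>, so it has a left inverse itself, which
  can only be \<open>x\<close>.\<close>

lemma unit_if_cong_one:
  assumes x: "x \<in> carrier R" "x \<ominus> \<one> \<in> jacobson_radical R"
  shows "x \<in> Units R"
proof -
  interpret J: ideal "jacobson_radical R" R by (rule ideal_jacobson_radical)
  obtain y where y: "y \<in> carrier R" "y \<otimes> x = \<one>"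
    using left_inverse_if_cong_one[OF x] by blast
  have "y \<ominus> \<one> = \<ominus> (y \<otimes> (x \<ominus> \<one>))"
    using x(1) y by (simp add: a_minus_def r_distr r_minus minus_add a_comm)
  then have "y \<ominus> \<one> \<in> jacobson_radical R"
    using J.I_l_closed[OF x(2) y(1)] J.a_inv_closed by simp
  then obtain z where z: "z \<in> carrier R" "z \<otimes> y = \<one>"
    using left_inverse_if_cong_one[OF y(1)] by blast
  have "z = z \<otimes> (y \<otimes> x)" using z y by simp
  also have "\<dots> = x" using x(1) y(1) z by (simp flip: m_assoc)
  finally show ?thesis using x(1) y z by (auto simp: Units_def)
qed

text \<open>The unit \<open>v = e f + (1 - e)(1 - f)\<close> is congruent to \<open>1\<close> modulo the radical and satisfies
  \<open>e v = e f = v f\<close>.\<close>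

lemma conjugate_if_idempotents_cong:
  assumes e: "idempotent R e" and f: "idempotent R f"
    and ef: "residue R e = residue R f"
  shows "conjugate R e f"
proof -
  interpret J: ideal "jacobson_radical R" R by (rule ideal_jacobson_radical)
  interpret h: ring_hom_ring R "semisimple_quotient R" "residue R"
    by (rule J.rcos_ring_hom_ring)
  let ?Q = "semisimple_quotient R"
  have c: "e \<in> carrier R" "f \<in> carrier R" and ee: "e \<otimes> e = e" and ff: "f \<otimes> f = f"
    using e f by (auto simp: idempotent_def)
  define v where "v = e \<otimes> f \<oplus> (\<one> \<ominus> e) \<otimes> (\<one> \<ominus> f)"
  have v: "v \<in> carrier R" using c by (simp add: v_def)
  have e0: "e \<otimes> (\<one> \<ominus> e) = \<zero>" and f0: "(\<one> \<ominus> f) \<otimes> f = \<zero>"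
    using c ee ff by (auto simp: a_minus_def r_distr l_distr r_minus l_minus r_neg)
  have "e \<otimes> v = e \<otimes> e \<otimes> f \<oplus> e \<otimes> (\<one> \<ominus> e) \<otimes> (\<one> \<ominus> f)"
    using c by (simp add: v_def r_distr m_assoc)
  then have ev: "e \<otimes> v = e \<otimes> f" using c by (simp add: e0 ee)
  have "v \<otimes> f = e \<otimes> (f \<otimes> f) \<oplus> (\<one> \<ominus> e) \<otimes> ((\<one> \<ominus> f) \<otimes> f)"
    using c by (simp add: v_def l_distr m_assoc)
  then have vf: "v \<otimes> f = e \<otimes> f" using c by (simp add: f0 ff)
  have "residue R v = residue R (e \<otimes> e \<oplus> (\<one> \<ominus> e) \<otimes> (\<one> \<ominus> e))"
    using c ef by (simp add: v_def a_minus_def)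
  also have "(\<one> \<ominus> e) \<otimes> (\<one> \<ominus> e) = \<one> \<ominus> e"
    using c by (simp add: a_minus_def l_distr r_distr l_minus r_minus ee r_neg l_neg)
  also have "e \<otimes> e \<oplus> (\<one> \<ominus> e) = \<one>"
    using c ee by (simp add: a_minus_def a_lcomm[of e \<one> "\<ominus> e"] r_neg)
  finally have "v \<in> Units R"
    using v unit_if_cong_one quotient_eq_iff_same_a_r_cos[OF ideal_jacobson_radical v one_closed]
    by blast
  moreover have "e = v \<otimes> f \<otimes> inv v"
    using ev vf c v Units_r_inv[OF \<open>v \<in> Units R\<close>] \<open>v \<in> Units R\<close>
    by (metis Units_inv_closed m_assoc r_one)
  ultimately show ?thesis by (auto simp: conjugate_def)
qed

end

section \<open>The descending chain condition\<close>

lemma left_artinian_minimal: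
  assumes R: "left_artinian_ring R" and F: "F \<noteq> {}" "\<And>I. I \<in> F \<Longrightarrow> left_ideal I R"
  shows "\<exists>I\<in>F. \<forall>J\<in>F. J \<subseteq> I \<longrightarrow> J = I"
proof (rule ccontr)
  assume "\<not> ?thesis"
  then have step: "\<exists>J. J \<in> F \<and> J \<subset> I" if "I \<in> F" for I
    using that by blast
  obtain I where I: "\<And>n. I n \<in> F \<and> I (Suc n) \<subset> I n"
    using dependent_nat_choice[of "\<lambda>_ I. I \<in> F" "\<lambda>_ I J. J \<subset> I"] F(1) step by (metis ex_in_conv)
  then have "\<exists>N. \<forall>n\<ge>N. I n = I N"
    using R F(2) unfolding left_artinian_ring_def by (meson psubset_imp_subset)
  then obtain N where "I (Suc N) = I N"
    by (meson le_SucI le_refl)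
  then show False
    using I[of N] by simp
qed

lemma (in ring) minus_eq_zero_iff:
  assumes "a \<in> carrier R" "b \<in> carrier R"
  shows "a \<ominus> b = \<zero> \<longleftrightarrow> a = b"
proof
  assume "a \<ominus> b = \<zero>"
  then have "(a \<ominus> b) \<oplus> b = b" using assms by simp
  then show "a = b" using assms by (simp add: a_minus_def a_assoc l_neg)
qed (use assms in \<open>simp add: a_minus_def r_neg\<close>)

text \<open>If \<open>s\<close> is right cancellable, a stationary chain \<open>R s\<^sup>N = R s\<^sup>N\<^sup>+\<^sup>1\<close> gives
  \<open>s\<^sup>N = y s s\<^sup>N\<close>, hence \<open>y s = 1\<close>; then \<open>(s y - 1) s = 0\<close> gives \<open>s y = 1\<close>.\<close>

lemma left_artinian_unit:
  assumes R: "left_artinian_ring R" and s: "s \<in> carrier R"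
    and reg: "\<And>x. x \<in> carrier R \<Longrightarrow> x \<otimes>\<^bsub>R\<^esub> s = \<zero>\<^bsub>R\<^esub> \<Longrightarrow> x = \<zero>\<^bsub>R\<^esub>"
  shows "s \<in> Units R"
proof -
  interpret ring R using R by (simp add: left_artinian_ring_def)
  let ?I = "\<lambda>n. {x \<otimes>\<^bsub>R\<^esub> (s [^]\<^bsub>R\<^esub> (n::nat)) | x. x \<in> carrier R}"
  have "?I (Suc n) \<subseteq> ?I n" for n
  proof
    fix y assume "y \<in> ?I (Suc n)"
    then obtain x where "x \<in> carrier R" "y = x \<otimes>\<^bsub>R\<^esub> (s [^]\<^bsub>R\<^esub> (Suc n))" by blast
    then have "x \<otimes>\<^bsub>R\<^esub> s \<in> carrier R" "y = (x \<otimes>\<^bsub>R\<^esub> s) \<otimes>\<^bsub>R\<^esub> (s [^]\<^bsub>R\<^esub> n)"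
      using s by (simp_all only: nat_pow_Suc2 m_assoc m_closed nat_pow_closed)
    then show "y \<in> ?I n" by blast
  qed
  moreover have "left_ideal (?I n) R" for n
    using s by (intro left_ideal_multiples) simp
  ultimately have "\<exists>N. \<forall>n\<ge>N. ?I n = ?I N"
    using R unfolding left_artinian_ring_def by (elim conjE allE[of _ ?I]) blast
  then obtain N where N: "?I (Suc N) = ?I N"
    by (meson le_SucI le_refl)
  have "\<one>\<^bsub>R\<^esub> \<otimes>\<^bsub>R\<^esub> s [^]\<^bsub>R\<^esub> N \<in> ?I (Suc N)"
    unfolding N by blast
  then obtain y where y: "y \<in> carrier R" "s [^]\<^bsub>R\<^esub> N = y \<otimes>\<^bsub>R\<^esub> s [^]\<^bsub>R\<^esub> (Suc N)"
    using s by auto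
  have cancel: "x = \<zero>\<^bsub>R\<^esub>" if "x \<in> carrier R" "x \<otimes>\<^bsub>R\<^esub> s [^]\<^bsub>R\<^esub> (n::nat) = \<zero>\<^bsub>R\<^esub>" for x n
    using that
  proof (induction n)
    case (Suc n)
    then have "x \<otimes>\<^bsub>R\<^esub> s [^]\<^bsub>R\<^esub> n \<otimes>\<^bsub>R\<^esub> s = \<zero>\<^bsub>R\<^esub>"
      using s by (simp add: m_assoc)
    then show ?case
      using Suc reg[of "x \<otimes>\<^bsub>R\<^esub> s [^]\<^bsub>R\<^esub> n"] s by simp
  qed simp
  have "y \<otimes>\<^bsub>R\<^esub> s \<otimes>\<^bsub>R\<^esub> s [^]\<^bsub>R\<^esub> N = s [^]\<^bsub>R\<^esub> N"
    using y s by (simp only: nat_pow_Suc2 m_assoc nat_pow_closed)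
  then have "(y \<otimes>\<^bsub>R\<^esub> s \<ominus>\<^bsub>R\<^esub> \<one>\<^bsub>R\<^esub>) \<otimes>\<^bsub>R\<^esub> s [^]\<^bsub>R\<^esub> N = \<zero>\<^bsub>R\<^esub>"
    using y(1) s by (simp add: a_minus_def l_distr l_minus r_neg)
  then have ys: "y \<otimes>\<^bsub>R\<^esub> s = \<one>\<^bsub>R\<^esub>"
    using cancel[of "y \<otimes>\<^bsub>R\<^esub> s \<ominus>\<^bsub>R\<^esub> \<one>\<^bsub>R\<^esub>" N] y(1) s by (simp add: minus_eq_zero_iff)
  have "(s \<otimes>\<^bsub>R\<^esub> y \<ominus>\<^bsub>R\<^esub> \<one>\<^bsub>R\<^esub>) \<otimes>\<^bsub>R\<^esub> s = \<zero>\<^bsub>R\<^esub>"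
    using y(1) s ys by (simp add: a_minus_def l_distr l_minus m_assoc r_neg)
  then have "s \<otimes>\<^bsub>R\<^esub> y = \<one>\<^bsub>R\<^esub>"
    using reg[of "s \<otimes>\<^bsub>R\<^esub> y \<ominus>\<^bsub>R\<^esub> \<one>\<^bsub>R\<^esub>"] y(1) s by (simp add: minus_eq_zero_iff)
  then show ?thesis
    using ys y(1) s by (auto simp: Units_def)
qed

lemma left_artinian_surjective_image:
  assumes R: "left_artinian_ring R" and hom: "ring_hom_ring R T h"
    and surj: "h ` carrier R = carrier T" and nontrivial: "\<one>\<^bsub>T\<^esub> \<noteq> \<zero>\<^bsub>T\<^esub>"
  shows "left_artinian_ring T"
  unfolding left_artinian_ring_def
proof (intro conjI allI impI)
  interpret h: ring_hom_ring R T h by fact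
  show "ring T" by (rule h.S.ring_axioms)
  show "\<one>\<^bsub>T\<^esub> \<noteq> \<zero>\<^bsub>T\<^esub>" by fact
  fix I :: "nat \<Rightarrow> 'c set"
  assume I: "(\<forall>n. left_ideal (I n) T) \<and> (\<forall>n. I (Suc n) \<subseteq> I n)"
  let ?P = "\<lambda>n. {x \<in> carrier R. h x \<in> I n}"
  have "left_ideal (?P n) R" for n
    using I by (intro h.R.left_idealI) (auto intro: h.S.left_idealD)
  moreover have "?P (Suc n) \<subseteq> ?P n" for n
    using I by blast
  ultimately obtain N where N: "\<And>n. n \<ge> N \<Longrightarrow> ?P n = ?P N"
    using R unfolding left_artinian_ring_def by (elim conjE allE[of _ ?P]) blast
  have image: "I n = h ` ?P n" for n
  proof
    have "I n \<subseteq> h ` carrier R"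
      unfolding surj using I by (blast dest: h.S.left_idealD(1))
    then show "I n \<subseteq> h ` ?P n" by blast
  qed blast
  have "I n = I N" if "n \<ge> N" for n
    using image[of n] image[of N] N[OF that] by simp
  then show "\<exists>N. \<forall>n\<ge>N. I n = I N" by blast
qed

lemma (in ring) carrier_Quot_image: "(+>) I ` carrier R = carrier (R Quot I)"
  unfolding FactRing_def A_RCOSETS_def' by auto

section \<open>Left denominator sets\<close>

locale denominator_set = ring R for R (structure) +
  fixes S \<aa>
  assumes Den: "S \<in> Den_l R \<aa>"
begin

lemma S_closed: "s \<in> S \<Longrightarrow> s \<in> carrier R"
  and one_S: "\<one> \<in> S"
  and mult_S: "s \<in> S \<Longrightarrow> t \<in> S \<Longrightarrow> s \<otimes> t \<in> S"
  and zero_notin_S: "\<zero> \<notin> S"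
  using Den
  by (auto simp: Den_l_def left_denominator_set_def left_ore_set_def multiplicative_set_def
      submonoid_def)

lemma ore:
  assumes "r \<in> carrier R" "s \<in> S"
  shows "\<exists>t\<in>S. \<exists>x\<in>carrier R. t \<otimes> r = x \<otimes> s"
proof -
  have "{t \<otimes> r | t. t \<in> S} \<inter> {x \<otimes> s | x. x \<in> carrier R} \<noteq> {}"
    using Den assms by (simp add: Den_l_def left_denominator_set_def left_ore_set_def)
  then show ?thesis by blast
qed

lemma mem_ass_iff: "a \<in> \<aa> \<longleftrightarrow> a \<in> carrier R \<and> (\<exists>s\<in>S. s \<otimes> a = \<zero>)"
  using Den by (auto simp: Den_l_def ass_def)

lemma mem_ass_if_right_zero:
  assumes "r \<in> carrier R" "s \<in> S" "r \<otimes> s = \<zero>"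
  shows "r \<in> \<aa>"
  using Den assms unfolding mem_ass_iff by (auto simp: Den_l_def left_denominator_set_def)

text \<open>For sums: if \<open>s a = 0\<close> and \<open>t b = 0\<close>, the Ore condition provides \<open>s' t = x s\<close> with
  \<open>s' \<in> S\<close>, and this element of \<open>S\<close> annihilates both \<open>a\<close> and \<open>b\<close>. For left multiples \<open>x a\<close> it
  provides \<open>t x = y s\<close> with \<open>t \<in> S\<close>, hence \<open>t x a = 0\<close>.\<close>

lemma ideal_ass: "ideal \<aa> R"
proof (rule ideal_if_left_ideal)
  have mult: "x \<otimes> a \<in> \<aa>" if "a \<in> \<aa>" and x: "x \<in> carrier R" for a x
  proof -
    obtain s where s: "s \<in> S" "s \<otimes> a = \<zero>" and a: "a \<in> carrier R"
      using \<open>a \<in> \<aa>\<close> mem_ass_iff by blast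
    obtain t y where t: "t \<in> S" "y \<in> carrier R" "t \<otimes> x = y \<otimes> s"
      using ore[OF x s(1)] by blast
    have "t \<otimes> (x \<otimes> a) = y \<otimes> (s \<otimes> a)"
      using a x s t S_closed by (metis m_assoc)
    then show ?thesis
      using mem_ass_iff a x s t by auto
  qed
  show "left_ideal \<aa> R"
  proof (rule left_idealI)
    show "\<aa> \<subseteq> carrier R" using mem_ass_iff by blast
    show "\<zero> \<in> \<aa>"
      unfolding mem_ass_iff using one_S by (intro conjI bexI[of _ \<one>]) simp_all
    show "x \<otimes> a \<in> \<aa>" if "x \<in> carrier R" "a \<in> \<aa>" for a x
      using mult that by blast
    fix a b assume "a \<in> \<aa>" "b \<in> \<aa>"
    then obtain s t where s: "s \<in> S" "s \<otimes> a = \<zero>" "a \<in> carrier R"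
      and t: "t \<in> S" "t \<otimes> b = \<zero>" "b \<in> carrier R"
      using mem_ass_iff by blast
    obtain s' x where s': "s' \<in> S" "x \<in> carrier R" "s' \<otimes> t = x \<otimes> s"
      using ore[OF S_closed[OF t(1)] s(1)] by blast
    note c = S_closed[OF s(1)] S_closed[OF t(1)] S_closed[OF s'(1)]
    have "s' \<otimes> t \<otimes> a = x \<otimes> (s \<otimes> a)"
      unfolding s'(3) using s s' c by (simp only: m_assoc)
    moreover have "s' \<otimes> t \<otimes> b = s' \<otimes> (t \<otimes> b)"
      using t c by (simp only: m_assoc)
    ultimately have "s' \<otimes> t \<otimes> (a \<oplus> b) = \<zero>"
      using s t s' c by (simp add: r_distr)
    then show "a \<oplus> b \<in> \<aa>"
      using mem_ass_iff mult_S s t s' by blast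
  qed
  show "a \<otimes> x \<in> \<aa>" if "a \<in> \<aa>" and x: "x \<in> carrier R" for a x
  proof -
    obtain s where s: "s \<in> S" "s \<otimes> a = \<zero>" "a \<in> carrier R"
      using \<open>a \<in> \<aa>\<close> mem_ass_iff by blast
    then have "s \<otimes> (a \<otimes> x) = \<zero>"
      using x S_closed by (simp flip: m_assoc)
    then show ?thesis using mem_ass_iff s x by blast
  qed
qed

lemma one_notin_ass: "\<one> \<notin> \<aa>"
  using S_closed zero_notin_S by (auto simp: mem_ass_iff)

lemma left_cancel_mod_ass:
  assumes "s \<in> S" "x \<in> carrier R" "s \<otimes> x \<in> \<aa>"
  shows "x \<in> \<aa>"
  using assms mult_S S_closed unfolding mem_ass_iff by (metis m_assoc)

lemma right_cancel_mod_ass: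
  assumes "s \<in> S" "x \<in> carrier R" "x \<otimes> s \<in> \<aa>"
  shows "x \<in> \<aa>"
proof -
  obtain t where "t \<in> S" "t \<otimes> (x \<otimes> s) = \<zero>"
    using assms mem_ass_iff by blast
  then have "t \<otimes> x \<in> \<aa>"
    using assms S_closed by (intro mem_ass_if_right_zero[of _ s]) (auto simp: m_assoc)
  then show ?thesis
    using left_cancel_mod_ass \<open>t \<in> S\<close> assms by blast
qed

lemma rcos_eq_zero_iff:
  assumes "r \<in> carrier R"
  shows "\<aa> +> r = \<zero>\<^bsub>R Quot \<aa>\<^esub> \<longleftrightarrow> r \<in> \<aa>"
  using assms a_rcos_zero[OF ideal_ass] ideal.rcos_const_imp_mem[OF ideal_ass]
  by (auto simp: FactRing_def)

text \<open>Modulo \<open>\<aa>\<close> the elements of \<open>S\<close> are cancellable, and cancellable elements of a left Artinian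
  ring are units. So the left Artinian ring \<open>R/\<aa>\<close> already inverts \<open>S\<close>.\<close>

lemma unit_mod_ass:
  assumes R: "left_artinian_ring R" and s: "s \<in> S"
  shows "\<aa> +> s \<in> Units (R Quot \<aa>)"
proof (rule left_artinian_unit)
  interpret I: ideal \<aa> R by (rule ideal_ass)
  interpret h: ring_hom_ring R "R Quot \<aa>" "(+>) \<aa>" by (rule I.rcos_ring_hom_ring)
  have surj: "(+>) \<aa> ` carrier R = carrier (R Quot \<aa>)"
    by (rule carrier_Quot_image)
  have "\<one>\<^bsub>R Quot \<aa>\<^esub> \<noteq> \<zero>\<^bsub>R Quot \<aa>\<^esub>"
    using rcos_eq_zero_iff[of \<one>] one_notin_ass h.hom_one by simp
  then show "left_artinian_ring (R Quot \<aa>)"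
    using left_artinian_surjective_image[OF R h.ring_hom_ring_axioms surj] by blast
  show "\<aa> +> s \<in> carrier (R Quot \<aa>)"
    using S_closed[OF s] by simp
  fix X assume "X \<in> carrier (R Quot \<aa>)" and X0: "X \<otimes>\<^bsub>R Quot \<aa>\<^esub> (\<aa> +> s) = \<zero>\<^bsub>R Quot \<aa>\<^esub>"
  then obtain x where x: "x \<in> carrier R" "X = \<aa> +> x"
    using surj by blast
  then have "\<aa> +> (x \<otimes> s) = \<zero>\<^bsub>R Quot \<aa>\<^esub>"
    using X0 S_closed[OF s] by simp
  then have "x \<otimes> s \<in> \<aa>"
    using rcos_eq_zero_iff x S_closed[OF s] by blast
  then have "x \<in> \<aa>"
    using right_cancel_mod_ass x s by blast
  then show "X = \<zero>\<^bsub>R Quot \<aa>\<^esub>"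
    using x rcos_eq_zero_iff by blast
qed

lemma finite_common_annihilator:
  assumes "finite F" "F \<subseteq> \<aa>"
  shows "\<exists>s\<in>S. \<forall>a\<in>F. s \<otimes> a = \<zero>"
  using assms
proof (induction F)
  case empty
  then show ?case using one_S by blast
next
  case (insert b F)
  then obtain s where s: "s \<in> S" "\<forall>a\<in>F. s \<otimes> a = \<zero>" by auto
  interpret I: ideal \<aa> R by (rule ideal_ass)
  have "s \<otimes> b \<in> \<aa>"
    using insert.prems s(1) S_closed I.I_l_closed by auto
  then obtain t where t: "t \<in> S" "t \<otimes> (s \<otimes> b) = \<zero>"
    using mem_ass_iff by blast
  have "(t \<otimes> s) \<otimes> a = \<zero>" if "a \<in> insert b F" for a
  proof -
    have "a \<in> carrier R" using that insert.prems I.a_subset by auto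
    then show ?thesis
      using that s t S_closed by (auto simp: m_assoc)
  qed
  then show ?case using mult_S[OF t(1) s(1)] by blast
qed

text \<open>Each finite subset of \<open>\<aa>\<close> is annihilated by some \<open>s \<in> S\<close>. The descending chain
  condition supplies a finite \<open>F \<subseteq> \<aa>\<close> with minimal left annihilator; enlarging \<open>F\<close> by any
  \<open>a \<in> \<aa>\<close> leaves this annihilator unchanged, so it annihilates all of \<open>\<aa>\<close>.\<close>

lemma common_annihilator:
  assumes R: "left_artinian_ring R"
  shows "\<exists>s\<in>S. \<forall>a\<in>\<aa>. s \<otimes> a = \<zero>"
proof -
  interpret I: ideal \<aa> R by (rule ideal_ass)
  define l where "l = (\<lambda>F. {x \<in> carrier R. \<forall>a\<in>F. x \<otimes> a = \<zero>})"
  have l_ideal: "left_ideal (l F) R" if "F \<subseteq> \<aa>" for F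
    using that I.a_subset by (intro left_idealI) (auto simp: l_def l_distr m_assoc subset_iff)
  let ?F = "{F. finite F \<and> F \<subseteq> \<aa>}"
  have "\<exists>I\<in>l ` ?F. \<forall>J\<in>l ` ?F. J \<subseteq> I \<longrightarrow> J = I"
    using l_ideal by (intro left_artinian_minimal[OF R]) auto
  then obtain F where "F \<in> ?F" and min: "\<forall>J\<in>l ` ?F. J \<subseteq> l F \<longrightarrow> J = l F"
    by (elim bexE imageE) simp
  then have F: "finite F" "F \<subseteq> \<aa>"
    by simp_all
  obtain s where s: "s \<in> S" "\<forall>a\<in>F. s \<otimes> a = \<zero>"
    using finite_common_annihilator[OF F] by blast
  have "s \<otimes> a = \<zero>" if "a \<in> \<aa>" for a
  proof -
    have "l (insert a F) = l F"
      using F that by (intro min[rule_format] imageI) (auto simp: l_def)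
    moreover have "s \<in> l F" using s S_closed by (simp add: l_def)
    ultimately show ?thesis by (auto simp: l_def)
  qed
  then show ?thesis using s by blast
qed

text \<open>If \<open>s \<aa> = 0\<close> and \<open>r s = 1 - a\<close> with \<open>a \<in> \<aa>\<close>, then \<open>a b = b\<close> for all \<open>b \<in> \<aa>\<close>. So \<open>a\<close> is
  an idempotent generating \<open>\<aa>\<close> as a right ideal and the complementary idempotent \<open>1 - a\<close>
  annihilates exactly \<open>\<aa>\<close>.\<close>

lemma exists_annihilating_idempotent:
  assumes R: "left_artinian_ring R"
  shows "\<exists>e. idempotent R e \<and> \<aa> = {r \<in> carrier R. e \<otimes> r = \<zero>}"
proof -
  interpret I: ideal \<aa> R by (rule ideal_ass)
  interpret h: ring_hom_ring R "R Quot \<aa>" "(+>) \<aa>" by (rule I.rcos_ring_hom_ring)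
  obtain s where s: "s \<in> S" "\<And>a. a \<in> \<aa> \<Longrightarrow> s \<otimes> a = \<zero>"
    using common_annihilator[OF R] by blast
  note sc = S_closed[OF s(1)]
  obtain X where X: "X \<in> carrier (R Quot \<aa>)" "X \<otimes>\<^bsub>R Quot \<aa>\<^esub> (\<aa> +> s) = \<one>\<^bsub>R Quot \<aa>\<^esub>"
    using unit_mod_ass[OF R s(1)] by (auto simp: Units_def)
  then obtain r where r: "r \<in> carrier R" "X = \<aa> +> r"
    unfolding carrier_Quot_image[symmetric] by blast
  define e where "e = r \<otimes> s"
  have e: "e \<in> carrier R" using r sc by (simp add: e_def)
  have "\<aa> +> \<one> = \<aa> +> e"
    using X r sc by (simp add: e_def del: h.hom_one) (metis h.hom_one)
  then have a: "\<one> \<ominus> e \<in> \<aa>"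
    using quotient_eq_iff_same_a_r_cos[OF ideal_ass _ e] by blast
  have ea: "e \<otimes> b = \<zero>" if "b \<in> \<aa>" for b
    using that r sc s(2) I.a_subset by (auto simp: e_def m_assoc)
  have "e \<otimes> (\<one> \<ominus> e) = \<zero>" by (rule ea[OF a])
  then have "e \<ominus> e \<otimes> e = \<zero>"
    using e by (simp add: a_minus_def r_distr r_minus)
  then have "e \<otimes> e = e" using e minus_eq_zero_iff[of e "e \<otimes> e"] by simp
  moreover have "b \<in> \<aa>" if b: "b \<in> carrier R" "e \<otimes> b = \<zero>" for b
  proof -
    have "(\<one> \<ominus> e) \<otimes> b = b"
      using b e by (simp add: a_minus_def l_distr l_minus)
    then show ?thesis using I.I_r_closed[OF a b(1)] by simp
  qed
  ultimately show ?thesis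
    using ea e I.a_subset by (intro exI[of _ e]) (auto simp: idempotent_def)
qed

lemma exists_idempotent_denominator_set:
  assumes R: "left_artinian_ring R"
  shows "\<exists>e. idempotent R e \<and> e \<noteq> \<zero> \<and> {\<one>, e} \<in> Den_l R \<aa>"
proof -
  interpret I: ideal \<aa> R by (rule ideal_ass)
  obtain e where idem: "idempotent R e" and \<aa>: "\<aa> = {r \<in> carrier R. e \<otimes> r = \<zero>}"
    using exists_annihilating_idempotent[OF R] by blast
  have e: "e \<in> carrier R" "e \<otimes> e = e"
    using idem by (simp_all add: idempotent_def)
  have e0: "e \<noteq> \<zero>"
  proof
    assume "e = \<zero>"
    then have "\<one> \<in> {r \<in> carrier R. e \<otimes> r = \<zero>}" by simp
    then show False using one_notin_ass \<aa> by blast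
  qed
  have one0: "\<one> \<noteq> \<zero>" using R by (simp add: left_artinian_ring_def)
  have "\<one> \<ominus> e \<in> \<aa>"
    unfolding \<aa> using e by (simp add: a_minus_def r_distr r_minus r_neg)
  \<comment> \<open>Since \<open>\<aa>\<close> is two-sided, \<open>e r (1 - e) = 0\<close>; this gives the Ore condition.\<close>
  have er: "e \<otimes> r = e \<otimes> r \<otimes> e" if r: "r \<in> carrier R" for r
  proof -
    have "e \<otimes> (r \<otimes> (\<one> \<ominus> e)) = \<zero>"
      using I.I_l_closed[OF \<open>\<one> \<ominus> e \<in> \<aa>\<close> r] \<aa> by blast
    then have "e \<otimes> r \<ominus> e \<otimes> r \<otimes> e = \<zero>"
      using e r by (simp add: a_minus_def r_distr r_minus m_assoc)
    then show ?thesis using e r by (subst (asm) minus_eq_zero_iff) simp_all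
  qed
  have "left_ore_set R {\<one>, e}"
    unfolding left_ore_set_def multiplicative_set_def
  proof (intro conjI ballI)
    show "submonoid {\<one>, e} R" using e by unfold_locales auto
    show "\<zero> \<notin> {\<one>, e}" using e0 one0 by auto
    fix r s assume r: "r \<in> carrier R" and "s \<in> {\<one>, e}"
    then consider "s = \<one>" | "s = e" by blast
    then show "{t \<otimes> r | t. t \<in> {\<one>, e}} \<inter> {x \<otimes> s | x. x \<in> carrier R} \<noteq> {}"
    proof cases
      case 1
      then have "\<one> \<otimes> r = r \<otimes> s" using r by simp
      then show ?thesis using r by blast
    next
      case 2
      then have "e \<otimes> r = (e \<otimes> r) \<otimes> s" using r er by simp
      then show ?thesis using r e by blast
    qed
  qed
  moreover have "\<exists>t\<in>{\<one>, e}. t \<otimes> r = \<zero>" if "r \<in> carrier R" "s \<in> {\<one>, e}" "r \<otimes> s = \<zero>" for r s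
  proof (cases "s = \<one>")
    case False
    then have "e \<otimes> r \<otimes> e = \<zero>" using that e by (auto simp: m_assoc)
    then show ?thesis using er that by auto
  qed (use that in simp)
  moreover have "ass R {\<one>, e} = \<aa>"
    unfolding \<aa> using e by (auto simp: ass_def)
  ultimately show ?thesis
    using e e0 by (auto simp: Den_l_def left_denominator_set_def idempotent_def)
qed

end

section \<open>The left localization as a quotient ring\<close>

context denominator_set
begin

text \<open>If \<open>h\<close> has kernel \<open>\<aa>\<close> and makes \<open>S\<close> invertible, two fractions are equal iff they have the
  same value \<open>X = h(s)\<^sup>-\<^sup>1 h(r)\<close>. The value is characterised by \<open>h(s) X = h(r)\<close>, which avoids
  inverses. Conversely, equal values of \<open>s\<^sup>-\<^sup>1 r\<close> and \<open>s'\<^sup>-\<^sup>1 r'\<close> with \<open>c s = d s' \<in> S\<close> only give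
  \<open>c r - d r' \<in> \<aa>\<close>; multiplying by some \<open>t \<in> S\<close> that annihilates this difference yields the
  common expansion.\<close>

lemma fraction_eq:
  assumes hom: "ring_hom_ring R T h"
    and ker: "\<And>r. r \<in> carrier R \<Longrightarrow> h r = \<zero>\<^bsub>T\<^esub> \<longleftrightarrow> r \<in> \<aa>"
    and units: "\<And>s. s \<in> S \<Longrightarrow> h s \<in> Units T"
    and s: "s \<in> S" and r: "r \<in> carrier R" and X: "X \<in> carrier T" "h s \<otimes>\<^bsub>T\<^esub> X = h r"
  shows "fraction R S s r = {(s', r'). s' \<in> S \<and> r' \<in> carrier R \<and> h s' \<otimes>\<^bsub>T\<^esub> X = h r'}"
proof -
  interpret h: ring_hom_ring R T h by fact
  have "((s, r), (s', r')) \<in> fraction_rel R S \<longleftrightarrow>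
      s' \<in> S \<and> r' \<in> carrier R \<and> h s' \<otimes>\<^bsub>T\<^esub> X = h r'" (is "?rel \<longleftrightarrow> ?den") for s' r'
  proof
    assume ?rel
    then obtain c d where s': "s' \<in> S" "r' \<in> carrier R" and cd: "c \<in> carrier R" "d \<in> carrier R"
      and eq: "c \<otimes> s = d \<otimes> s'" "c \<otimes> s \<in> S" "c \<otimes> r = d \<otimes> r'"
      unfolding fraction_rel_def by blast
    note c = cd s' r S_closed[OF s] S_closed[OF s'(1)]
    have "h d = h (d \<otimes> s') \<otimes>\<^bsub>T\<^esub> inv\<^bsub>T\<^esub> (h s')"
      using c units[OF s'(1)] by (simp add: h.S.m_assoc)
    then have d: "h d \<in> Units T"
      using units[of "d \<otimes> s'"] units[OF s'(1)] eq by (simp del: h.hom_mult)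
    have "h d \<otimes>\<^bsub>T\<^esub> (h s' \<otimes>\<^bsub>T\<^esub> X) = h (d \<otimes> s') \<otimes>\<^bsub>T\<^esub> X"
      using c X by (simp add: h.S.m_assoc)
    also have "\<dots> = h c \<otimes>\<^bsub>T\<^esub> (h s \<otimes>\<^bsub>T\<^esub> X)"
      unfolding eq(1)[symmetric] using c X(1) by (simp add: h.S.m_assoc)
    also have "\<dots> = h (c \<otimes> r)"
      using c X by simp
    also have "\<dots> = h d \<otimes>\<^bsub>T\<^esub> h r'"
      unfolding eq(3) using c by simp
    finally have "h s' \<otimes>\<^bsub>T\<^esub> X = h r'"
      using d c X by (subst (asm) h.S.Units_l_cancel) simp_all
    then show ?den using s' by simp
  next
    assume den: ?den
    obtain c d where cd: "c \<in> S" "d \<in> carrier R" "c \<otimes> s = d \<otimes> s'"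
      using ore[OF S_closed[OF s]] den by blast
    note c = cd(2) r S_closed[OF cd(1)] S_closed[OF s] S_closed[of s']
    have "h (c \<otimes> r) = h (c \<otimes> s) \<otimes>\<^bsub>T\<^esub> X"
      using c X(1) by (simp add: h.S.m_assoc flip: X(2))
    also have "\<dots> = h (d \<otimes> r')"
      unfolding cd(3) using den c X(1) by (simp add: h.S.m_assoc)
    finally have "h (c \<otimes> r \<ominus> d \<otimes> r') = \<zero>\<^bsub>T\<^esub>"
      using den c by (simp add: a_minus_def h.S.r_neg del: h.hom_mult)
    then have "c \<otimes> r \<ominus> d \<otimes> r' \<in> \<aa>"
      using ker den c by simp
    then obtain t where t: "t \<in> S" "t \<otimes> (c \<otimes> r \<ominus> d \<otimes> r') = \<zero>"
      using mem_ass_iff by blast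
    note tc = S_closed[OF t(1)]
    have "t \<otimes> c \<otimes> r \<ominus> t \<otimes> d \<otimes> r' = \<zero>"
      using t(2) tc c den by (simp add: a_minus_def r_distr r_minus m_assoc)
    then have "t \<otimes> c \<otimes> r = t \<otimes> d \<otimes> r'"
      using tc c den by (subst (asm) minus_eq_zero_iff) simp_all
    moreover have "t \<otimes> c \<otimes> s = t \<otimes> d \<otimes> s'"
      using tc c den cd by (simp add: m_assoc)
    moreover have "t \<otimes> c \<otimes> s \<in> S"
      using t cd s by (simp add: mult_S)
    moreover have "t \<otimes> c \<in> carrier R" "t \<otimes> d \<in> carrier R"
      using tc c by simp_all
    ultimately show ?rel
      using den s r unfolding fraction_rel_def by blast
  qed
  then show ?thesis
    unfolding fraction_def by blast
qed

text \<open>A class of fractions is determined by its value \<open>X = h(s)\<^sup>-\<^sup>1 h(r)\<close> in \<open>T\<close>. The isomorphism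
  sends \<open>X\<close> to the class of all fractions of value \<open>X\<close>; in the unions that define the operations
  of the localization, every member is then this one class.\<close>

lemma localization_iso:
  assumes hom: "ring_hom_ring R T h" and surj: "h ` carrier R = carrier T"
    and ker: "\<And>r. r \<in> carrier R \<Longrightarrow> h r = \<zero>\<^bsub>T\<^esub> \<longleftrightarrow> r \<in> \<aa>"
    and units: "\<And>s. s \<in> S \<Longrightarrow> h s \<in> Units T"
  shows "\<exists>g \<in> ring_iso T (left_localization R S). \<forall>r\<in>carrier R. g (h r) = fraction R S \<one> r"
proof -
  interpret h: ring_hom_ring R T h by fact
  define g where "g = (\<lambda>X. {(s, r). s \<in> S \<and> r \<in> carrier R \<and> h s \<otimes>\<^bsub>T\<^esub> X = h r})"
  let ?L = "left_localization R S"
  have fraction: "fraction R S s r = g X"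
    if "s \<in> S" "r \<in> carrier R" "X \<in> carrier T" "h s \<otimes>\<^bsub>T\<^esub> X = h r" for s r X
    unfolding g_def using fraction_eq[OF hom ker units that] by blast
  have fraction_one: "fraction R S \<one> r = g (h r)" if "r \<in> carrier R" for r
    using that one_S by (intro fraction) simp_all
  have one_mem: "(\<one>, x) \<in> g (h x)" if "x \<in> carrier R" for x
    using that one_S by (simp add: g_def)
  have gD: "s \<in> S" "s \<in> carrier R" "r \<in> carrier R" "h s \<otimes>\<^bsub>T\<^esub> X = h r" if "(s, r) \<in> g X" for s r X
    using that S_closed by (auto simp: g_def)
  have carrier: "carrier ?L = g ` carrier T"
  proof
    show "carrier ?L \<subseteq> g ` carrier T"
    proof
      fix P assume "P \<in> carrier ?L"
      then obtain s r where P: "P = fraction R S s r" "s \<in> S" "r \<in> carrier R"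
        by (auto simp: left_localization_def fraction_def elim!: quotientE)
      have u: "h s \<in> Units T" using units P by blast
      have hs: "h s \<in> carrier T" "h r \<in> carrier T"
        using P(2,3) S_closed by simp_all
      let ?X = "inv\<^bsub>T\<^esub> (h s) \<otimes>\<^bsub>T\<^esub> h r"
      have X: "?X \<in> carrier T"
        using u hs by simp
      have "h s \<otimes>\<^bsub>T\<^esub> ?X = h r"
        using u hs h.S.m_assoc[of "h s" "inv\<^bsub>T\<^esub> (h s)" "h r"] by simp
      then have "P = g ?X"
        unfolding P(1) by (rule fraction[OF P(2,3) X])
      then show "P \<in> g ` carrier T" using X by blast
    qed
    show "g ` carrier T \<subseteq> carrier ?L"
    proof
      fix P assume "P \<in> g ` carrier T"
      then obtain r where "r \<in> carrier R" "P = g (h r)"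
        unfolding surj[symmetric] by blast
      then have "r \<in> carrier R" "P = fraction R S \<one> r"
        using fraction_one by simp_all
      then show "P \<in> carrier ?L"
        using one_S by (auto simp: left_localization_def fraction_def intro!: quotientI)
    qed
  qed
  have "g \<in> ring_iso T ?L"
  proof (rule ring_iso_memI)
    show "g X \<in> carrier ?L" if "X \<in> carrier T" for X
      using that carrier by blast
    have "inj_on g (carrier T)"
    proof (rule inj_onI)
      fix X Y assume X: "X \<in> carrier T" and Y: "Y \<in> carrier T" and eq: "g X = g Y"
      obtain x where x: "x \<in> carrier R" "X = h x"
        using X unfolding surj[symmetric] by blast
      then have "(\<one>, x) \<in> g Y" using eq one_mem[OF x(1)] by simp
      then show "X = Y" using gD(4)[of \<one> x Y] x Y by simp
    qed
    then show "bij_betw g (carrier T) (carrier ?L)"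
      by (simp add: bij_betw_def carrier)
    show "g \<one>\<^bsub>T\<^esub> = \<one>\<^bsub>?L\<^esub>"
      using fraction_one[of \<one>] by (simp add: left_localization_def)
  next
    fix X Y assume X: "X \<in> carrier T" and Y: "Y \<in> carrier T"
    obtain x y where x: "x \<in> carrier R" "X = h x" and y: "y \<in> carrier R" "Y = h y"
      using X Y unfolding surj[symmetric] by blast
    let ?M = "{fraction R S (t \<otimes> s) (c \<otimes> r') | s r s' r' t c.
                 (s, r) \<in> g X \<and> (s', r') \<in> g Y \<and> t \<in> S \<and> c \<in> carrier R \<and> t \<otimes> r = c \<otimes> s'}"
    have "fraction R S (t \<otimes> s) (c \<otimes> r') = g (X \<otimes>\<^bsub>T\<^esub> Y)"
      if sr: "(s, r) \<in> g X" "(s', r') \<in> g Y" and t: "t \<in> S" "c \<in> carrier R" "t \<otimes> r = c \<otimes> s'"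
      for s r s' r' t c
    proof (rule fraction)
      note c = gD(2,3)[OF sr(1)] gD(2,3)[OF sr(2)] S_closed[OF t(1)] t(2)
      show "t \<otimes> s \<in> S" using gD(1)[OF sr(1)] t by (simp add: mult_S)
      show "c \<otimes> r' \<in> carrier R" "X \<otimes>\<^bsub>T\<^esub> Y \<in> carrier T" using c X Y by simp_all
      have "h (t \<otimes> s) \<otimes>\<^bsub>T\<^esub> (X \<otimes>\<^bsub>T\<^esub> Y) = h t \<otimes>\<^bsub>T\<^esub> (h s \<otimes>\<^bsub>T\<^esub> X) \<otimes>\<^bsub>T\<^esub> Y"
        using c X Y by (simp add: h.S.m_assoc)
      also have "\<dots> = h (t \<otimes> r) \<otimes>\<^bsub>T\<^esub> Y"
        using c gD(4)[OF sr(1)] by simp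
      also have "\<dots> = h c \<otimes>\<^bsub>T\<^esub> (h s' \<otimes>\<^bsub>T\<^esub> Y)"
        unfolding t(3) using c Y by (simp add: h.S.m_assoc)
      also have "\<dots> = h (c \<otimes> r')"
        using c gD(4)[OF sr(2)] by simp
      finally show "h (t \<otimes> s) \<otimes>\<^bsub>T\<^esub> (X \<otimes>\<^bsub>T\<^esub> Y) = h (c \<otimes> r')" .
    qed
    then have "?M \<subseteq> {g (X \<otimes>\<^bsub>T\<^esub> Y)}" by blast
    moreover have "fraction R S (\<one> \<otimes> \<one>) (x \<otimes> y) \<in> ?M"
    proof -
      have "(\<one>, x) \<in> g X" "(\<one>, y) \<in> g Y" "\<one> \<otimes> x = x \<otimes> \<one>"
        using x y one_mem by simp_all
      then show ?thesis using one_S x by blast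
    qed
    ultimately have "?M = {g (X \<otimes>\<^bsub>T\<^esub> Y)}" by blast
    then have "\<Union>?M = g (X \<otimes>\<^bsub>T\<^esub> Y)" by simp
    then show "g (X \<otimes>\<^bsub>T\<^esub> Y) = g X \<otimes>\<^bsub>?L\<^esub> g Y"
      by (simp add: left_localization_def)
    let ?A = "{fraction R S (c \<otimes> s) (c \<otimes> r \<oplus> d \<otimes> r') | s r s' r' c d.
                 (s, r) \<in> g X \<and> (s', r') \<in> g Y \<and> c \<in> carrier R \<and> d \<in> carrier R \<and>
                 c \<otimes> s = d \<otimes> s' \<and> c \<otimes> s \<in> S}"
    have "fraction R S (c \<otimes> s) (c \<otimes> r \<oplus> d \<otimes> r') = g (X \<oplus>\<^bsub>T\<^esub> Y)"
      if sr: "(s, r) \<in> g X" "(s', r') \<in> g Y" and cd: "c \<in> carrier R" "d \<in> carrier R"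
        and eq: "c \<otimes> s = d \<otimes> s'" "c \<otimes> s \<in> S"
      for s r s' r' c d
    proof (rule fraction)
      note c = gD(2,3)[OF sr(1)] gD(2,3)[OF sr(2)] cd
      show "c \<otimes> s \<in> S" by fact
      show "c \<otimes> r \<oplus> d \<otimes> r' \<in> carrier R" "X \<oplus>\<^bsub>T\<^esub> Y \<in> carrier T" using c X Y by simp_all
      have "h (c \<otimes> s) \<otimes>\<^bsub>T\<^esub> (X \<oplus>\<^bsub>T\<^esub> Y) = h (c \<otimes> s) \<otimes>\<^bsub>T\<^esub> X \<oplus>\<^bsub>T\<^esub> h (d \<otimes> s') \<otimes>\<^bsub>T\<^esub> Y"
        using c X Y eq(1) by (simp add: h.S.r_distr del: h.hom_mult)
      also have "\<dots> = h c \<otimes>\<^bsub>T\<^esub> (h s \<otimes>\<^bsub>T\<^esub> X) \<oplus>\<^bsub>T\<^esub> h d \<otimes>\<^bsub>T\<^esub> (h s' \<otimes>\<^bsub>T\<^esub> Y)"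
        using c X Y by (simp add: h.S.m_assoc)
      also have "\<dots> = h (c \<otimes> r \<oplus> d \<otimes> r')"
        using c gD(4)[OF sr(1)] gD(4)[OF sr(2)] by simp
      finally show "h (c \<otimes> s) \<otimes>\<^bsub>T\<^esub> (X \<oplus>\<^bsub>T\<^esub> Y) = h (c \<otimes> r \<oplus> d \<otimes> r')" .
    qed
    then have "?A \<subseteq> {g (X \<oplus>\<^bsub>T\<^esub> Y)}" by blast
    moreover have "fraction R S (\<one> \<otimes> \<one>) (\<one> \<otimes> x \<oplus> \<one> \<otimes> y) \<in> ?A"
    proof -
      have "(\<one>, x) \<in> g X" "(\<one>, y) \<in> g Y" "\<one> \<otimes> \<one> = \<one> \<otimes> \<one>" "\<one> \<otimes> \<one> \<in> S"
        using x y one_mem one_S by simp_all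
      then show ?thesis using one_closed by blast
    qed
    ultimately have "?A = {g (X \<oplus>\<^bsub>T\<^esub> Y)}" by blast
    then have "\<Union>?A = g (X \<oplus>\<^bsub>T\<^esub> Y)" by simp
    then show "g (X \<oplus>\<^bsub>T\<^esub> Y) = g X \<oplus>\<^bsub>?L\<^esub> g Y"
      by (simp add: left_localization_def)
  qed
  then show ?thesis using fraction_one by auto
qed

lemma localization_iso_Quot:
  assumes R: "left_artinian_ring R"
  shows "\<exists>g \<in> ring_iso (R Quot \<aa>) (left_localization R S).
           \<forall>r\<in>carrier R. g (\<aa> +> r) = fraction R S \<one> r"
proof (rule localization_iso)
  show "ring_hom_ring R (R Quot \<aa>) ((+>) \<aa>)"
    using ideal.rcos_ring_hom_ring[OF ideal_ass] .
qed (use carrier_Quot_image rcos_eq_zero_iff unit_mod_ass[OF R] in auto)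

end

text \<open>Both localizations are the ring \<open>R/\<aa>\<close>.\<close>

lemma R_isomorphic_if_same_ass:
  assumes R: "left_artinian_ring R" and S: "S \<in> Den_l R \<aa>" and S': "S' \<in> Den_l R \<aa>"
  shows "R_isomorphic_localizations R S S'"
proof -
  interpret ring R using R by (simp add: left_artinian_ring_def)
  interpret S: denominator_set R S \<aa> by unfold_locales fact
  interpret S': denominator_set R S' \<aa> by unfold_locales fact
  interpret I: ideal \<aa> R by (rule S.ideal_ass)
  obtain g where g: "g \<in> ring_iso (R Quot \<aa>) (left_localization R S)"
    "\<And>r. r \<in> carrier R \<Longrightarrow> g (\<aa> +>\<^bsub>R\<^esub> r) = fraction R S \<one>\<^bsub>R\<^esub> r"
    using S.localization_iso_Quot[OF R] by blast
  obtain g' where g': "g' \<in> ring_iso (R Quot \<aa>) (left_localization R S')"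
    "\<And>r. r \<in> carrier R \<Longrightarrow> g' (\<aa> +>\<^bsub>R\<^esub> r) = fraction R S' \<one>\<^bsub>R\<^esub> r"
    using S'.localization_iso_Quot[OF R] by blast
  let ?k = "inv_into (carrier (R Quot \<aa>)) g"
  have "g' \<circ> ?k \<in> ring_iso (left_localization R S) (left_localization R S')"
    using ring_iso_set_sym[OF I.quotient_is_ring g(1)] g'(1) by (rule ring_iso_set_trans)
  moreover have "(g' \<circ> ?k) (fraction R S \<one>\<^bsub>R\<^esub> r) = fraction R S' \<one>\<^bsub>R\<^esub> r" if r: "r \<in> carrier R" for r
  proof -
    have "inj_on g (carrier (R Quot \<aa>))"
      using ring_iso_memE(5)[OF g(1)] by (simp add: bij_betw_def)
    moreover have "\<aa> +>\<^bsub>R\<^esub> r \<in> carrier (R Quot \<aa>)"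
      using r carrier_Quot_image by blast
    ultimately have "?k (g (\<aa> +>\<^bsub>R\<^esub> r)) = \<aa> +>\<^bsub>R\<^esub> r"
      by (rule inv_into_f_f)
    then show ?thesis using g(2)[OF r] g'(2)[OF r] by simp
  qed
  ultimately show ?thesis
    unfolding R_isomorphic_localizations_def by blast
qed

lemma exists_localizing_idempotent:
  assumes R: "left_artinian_ring R" and S: "S \<in> Den_l R \<aa>"
  shows "\<exists>e. localizing_idempotent R S \<aa> e"
proof -
  interpret ring R using R by (simp add: left_artinian_ring_def)
  interpret S: denominator_set R S \<aa> by unfold_locales fact
  obtain e where "idempotent R e" "e \<noteq> \<zero>\<^bsub>R\<^esub>" "{\<one>\<^bsub>R\<^esub>, e} \<in> Den_l R \<aa>"
    using S.exists_idempotent_denominator_set[OF R] by blast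
  then show ?thesis
    using R_isomorphic_if_same_ass[OF R S] unfolding localizing_idempotent_def by blast
qed

section \<open>Ideals of a product of simple rings\<close>

lemma (in ring) left_ideal_finsum_closed:
  assumes I: "left_ideal I R" and "finite A" "\<And>i. i \<in> A \<Longrightarrow> f i \<in> I"
  shows "finsum R f A \<in> I"
  using assms(2,3)
proof (induction A)
  case empty
  then show ?case using left_idealD(2)[OF I] by simp
next
  case (insert i A)
  then have "f \<in> A \<rightarrow> carrier R" "f i \<in> carrier R"
    using left_idealD(1)[OF I] by auto
  then show ?case
    using insert left_idealD(3)[OF I] by (simp add: finsum_insert)
qed

lemma (in ring_hom_ring) hom_finsum_eq:
  assumes "finite A" "\<And>i. i \<in> A \<Longrightarrow> f i \<in> carrier R"
  shows "h (finsum R f A) = finsum S (\<lambda>i. h (f i)) A"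
  using assms
proof (induction A)
  case (insert i A)
  then have "f \<in> A \<rightarrow> carrier R" "(\<lambda>i. h (f i)) \<in> A \<rightarrow> carrier S"
    by auto
  then show ?case
    using insert by (simp add: R.finsum_insert S.finsum_insert)
qed simp

text \<open>Both the lifted idempotents of a ring and their residues are such a family.\<close>

locale orthogonal_idempotents = ring R for R (structure) +
  fixes n :: nat and u
  assumes u_idem: "\<And>i. i \<in> {1..n} \<Longrightarrow> idempotent R (u i)"
    and u_orth: "\<And>i j. i \<in> {1..n} \<Longrightarrow> j \<in> {1..n} \<Longrightarrow> i \<noteq> j \<Longrightarrow> u i \<otimes> u j = \<zero>"
    and u_sum: "finsum R u {1..n} = \<one>"
begin

lemma u_closed: "i \<in> {1..n} \<Longrightarrow> u i \<in> carrier R"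
  using u_idem by (simp add: idempotent_def)

lemma sum_closed: "I \<subseteq> {1..n} \<Longrightarrow> finsum R u I \<in> carrier R"
  using u_closed by (intro finsum_closed) auto

lemma
  assumes I: "I \<subseteq> {1..n}" and j: "j \<in> {1..n}"
  shows mult_sum: "u j \<otimes> finsum R u I = (if j \<in> I then u j else \<zero>)"
    and sum_mult: "finsum R u I \<otimes> u j = (if j \<in> I then u j else \<zero>)"
proof -
  have fin: "finite I" using I finite_subset by blast
  have u: "u \<in> I \<rightarrow> carrier R" using I u_closed by auto
  have delta: "finsum R (\<lambda>i. if j = i then u i else \<zero>) I = (if j \<in> I then u j else \<zero>)"
  proof (cases "j \<in> I")
    case True
    then show ?thesis using finsum_singleton[OF True fin u] by simp
  next
    case False
    then have "finsum R (\<lambda>i. if j = i then u i else \<zero>) I = finsum R (\<lambda>i. \<zero>) I"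
      by (intro finsum_cong') auto
    then show ?thesis using False by simp
  qed
  have "u j \<otimes> finsum R u I = finsum R (\<lambda>i. u j \<otimes> u i) I"
    by (rule finsum_rdistr[OF fin u_closed[OF j] u])
  also have "\<dots> = finsum R (\<lambda>i. if j = i then u i else \<zero>) I"
    using I j u_idem u_orth u_closed by (intro finsum_cong') (auto simp: idempotent_def subset_iff)
  finally show "u j \<otimes> finsum R u I = (if j \<in> I then u j else \<zero>)"
    using delta by simp
  have "finsum R u I \<otimes> u j = finsum R (\<lambda>i. u i \<otimes> u j) I"
    by (rule finsum_ldistr[OF fin u_closed[OF j] u])
  also have "\<dots> = finsum R (\<lambda>i. if j = i then u i else \<zero>) I"
    using I j u_idem u_orth u_closed by (intro finsum_cong') (auto simp: idempotent_def subset_iff)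
  finally show "finsum R u I \<otimes> u j = (if j \<in> I then u j else \<zero>)"
    using delta by simp
qed

lemma idempotent_sum:
  assumes I: "I \<subseteq> {1..n}"
  shows "idempotent R (finsum R u I)"
proof -
  have fin: "finite I" using I finite_subset by blast
  have u: "u \<in> I \<rightarrow> carrier R" using I u_closed by auto
  have "finsum R u I \<otimes> finsum R u I = finsum R (\<lambda>i. u i \<otimes> finsum R u I) I"
    by (rule finsum_ldistr[OF fin sum_closed[OF I] u])
  also have "\<dots> = finsum R u I"
    using mult_sum[OF I] I u by (intro finsum_cong') auto
  finally show ?thesis using sum_closed[OF I] by (simp add: idempotent_def)
qed

lemma sum_complement:
  assumes I: "I \<subseteq> {1..n}"
  shows "finsum R u ({1..n} - I) = \<one> \<ominus> finsum R u I"
proof -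
  have fin: "finite I" using I finite_subset by blast
  have "finsum R u (I \<union> ({1..n} - I)) = finsum R u I \<oplus> finsum R u ({1..n} - I)"
    using I u_closed fin by (intro finsum_Un_disjoint) auto
  moreover have "I \<union> ({1..n} - I) = {1..n}" using I by blast
  ultimately have "\<one> = finsum R u I \<oplus> finsum R u ({1..n} - I)"
    using u_sum by simp
  then show ?thesis
    using sum_closed[OF I] sum_closed[of "{1..n} - I"]
    by (simp add: a_minus_def a_comm[of "finsum R u I"] a_assoc r_neg)
qed

lemma sum_of_components:
  assumes "x \<in> carrier R"
  shows "x = finsum R (\<lambda>i. x \<otimes> u i) {1..n}"
proof -
  have u: "u \<in> {1..n} \<rightarrow> carrier R" using u_closed by auto
  show ?thesis
    using finsum_rdistr[OF _ assms u] u_sum assms by simp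
qed

lemma eq_if_components_eq:
  assumes x: "x \<in> carrier R" and y: "y \<in> carrier R"
    and eq: "\<And>i. i \<in> {1..n} \<Longrightarrow> x \<otimes> u i = y \<otimes> u i"
  shows "x = y"
proof -
  have "finsum R (\<lambda>i. x \<otimes> u i) {1..n} = finsum R (\<lambda>i. y \<otimes> u i) {1..n}"
    using eq y u_closed by (intro finsum_cong') auto
  then show ?thesis using sum_of_components[OF x] sum_of_components[OF y] by simp
qed

end

locale simple_decomposition = orthogonal_idempotents Q n c for Q (structure) and n c +
  assumes factors: "simple_factors Q n c"
begin

abbreviation "factor \<equiv> \<lambda>i. Q\<lparr>carrier := left_multiples Q (c i), one := c i\<rparr>"

lemma simple_factor: "i \<in> {1..n} \<Longrightarrow> simple_ring (factor i)"
  using factors by (simp add: simple_factors_def)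

lemma factor_nonzero:
  assumes "i \<in> {1..n}"
  shows "c i \<noteq> \<zero>"
  using simple_factor[OF assms] by (simp add: simple_ring_def)

lemma ideal_factor:
  assumes B: "ideal B Q" and i: "i \<in> {1..n}"
  shows "ideal (B \<inter> left_multiples Q (c i)) (factor i)"
proof -
  interpret B: ideal B Q by fact
  interpret F: ring "factor i" using simple_factor[OF i] by (simp add: simple_ring_def)
  have sub: "left_multiples Q (c i) \<subseteq> carrier Q"
    using i u_closed by (auto simp: left_multiples_def)
  have "left_ideal (B \<inter> left_multiples Q (c i)) (factor i)"
  proof (rule F.left_idealI)
    show "\<zero>\<^bsub>factor i\<^esub> \<in> B \<inter> left_multiples Q (c i)"
      using F.zero_closed by simp
    show "a \<oplus>\<^bsub>factor i\<^esub> b \<in> B \<inter> left_multiples Q (c i)"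
      if "a \<in> B \<inter> left_multiples Q (c i)" "b \<in> B \<inter> left_multiples Q (c i)" for a b
      using that F.a_closed[of a b] by simp
    show "x \<otimes>\<^bsub>factor i\<^esub> a \<in> B \<inter> left_multiples Q (c i)"
      if "x \<in> carrier (factor i)" "a \<in> B \<inter> left_multiples Q (c i)" for x a
      using that F.m_closed[of x a] B.I_l_closed sub by auto
  qed simp
  then show ?thesis
  proof (rule F.ideal_if_left_ideal)
    show "a \<otimes>\<^bsub>factor i\<^esub> x \<in> B \<inter> left_multiples Q (c i)"
      if "a \<in> B \<inter> left_multiples Q (c i)" "x \<in> carrier (factor i)" for x a
      using that F.m_closed[of a x] B.I_r_closed sub by auto
  qed
qed

text \<open>An ideal \<open>B\<close> meets each simple factor in \<open>0\<close> or in the whole factor, and it meets it in the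
  whole factor exactly when \<open>c\<^sub>i \<in> B\<close>.\<close>

lemma ideal_eq_multiples:
  assumes B: "ideal B Q"
  defines "I \<equiv> {i \<in> {1..n}. c i \<in> B}"
  shows "B = left_multiples Q (finsum Q c I)"
proof
  interpret B: ideal B Q by fact
  have I: "I \<subseteq> {1..n}" by (auto simp: I_def)
  have fin: "finite I" by (simp add: I_def)
  have BL: "left_ideal B Q"
    using B.I_l_closed B.additive_subgroup_axioms by (simp add: left_ideal_def)
  have "finsum Q c I \<in> B"
    using fin by (intro left_ideal_finsum_closed[OF BL]) (auto simp: I_def)
  then show "left_multiples Q (finsum Q c I) \<subseteq> B"
    using B.I_l_closed by (auto simp: left_multiples_def)
  show "B \<subseteq> left_multiples Q (finsum Q c I)"
  proof
    fix b assume b: "b \<in> B"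
    then have bc: "b \<in> carrier Q" using B.a_subset by blast
    have "b = b \<otimes> finsum Q c I"
    proof (rule eq_if_components_eq)
      fix i assume i: "i \<in> {1..n}"
      show "b \<otimes> c i = b \<otimes> finsum Q c I \<otimes> c i"
      proof (cases "i \<in> I")
        case True
        then show ?thesis
          using bc i u_closed sum_closed[OF I] by (simp add: m_assoc sum_mult[OF I i])
      next
        case False
        have "c i \<in> left_multiples Q (c i)"
          using u_closed[OF i] by (auto simp: left_multiples_def intro!: exI[of _ \<one>])
        then have "B \<inter> left_multiples Q (c i) \<noteq> left_multiples Q (c i)"
          using False i by (auto simp: I_def)
        then have "B \<inter> left_multiples Q (c i) = {\<zero>}"
          using simple_factor[OF i] ideal_factor[OF B i] by (auto simp: simple_ring_def)
        moreover have "b \<otimes> c i \<in> B \<inter> left_multiples Q (c i)"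
          using b bc B.I_r_closed u_closed[OF i] by (auto simp: left_multiples_def)
        ultimately have "b \<otimes> c i = \<zero>" by blast
        then show ?thesis
          using False bc i u_closed sum_closed[OF I] by (simp add: m_assoc sum_mult[OF I i])
      qed
    qed (use bc sum_closed[OF I] in auto)
    then show "b \<in> left_multiples Q (finsum Q c I)"
      using bc by (auto simp: left_multiples_def)
  qed
qed

text \<open>Applied in both directions, this makes the index set of an ideal unique.\<close>

lemma subset_if_multiples_subset:
  assumes I: "I \<subseteq> {1..n}" and J: "J \<subseteq> {1..n}"
    and sub: "left_multiples Q (finsum Q c I) \<subseteq> left_multiples Q (finsum Q c J)"
  shows "I \<subseteq> J"
proof
  fix i assume i: "i \<in> I"
  then have i': "i \<in> {1..n}" using I by blast
  have "c i = c i \<otimes> finsum Q c I"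
    using i mult_sum[OF I i'] by simp
  then have "c i \<in> left_multiples Q (finsum Q c I)"
    using u_closed[OF i'] by (auto simp: left_multiples_def)
  then obtain q where q: "q \<in> carrier Q" "c i = q \<otimes> finsum Q c J"
    using sub by (auto simp: left_multiples_def)
  have "c i = c i \<otimes> c i"
    using u_idem[OF i'] by (simp add: idempotent_def)
  also have "\<dots> = q \<otimes> finsum Q c J \<otimes> c i"
    using q(2) by simp
  also have "\<dots> = q \<otimes> (finsum Q c J \<otimes> c i)"
    using q(1) sum_closed[OF J] u_closed[OF i'] by (simp add: m_assoc)
  finally show "i \<in> J"
    using sum_mult[OF J i'] factor_nonzero[OF i'] q(1) by (auto split: if_splits)
qed

end

section \<open>The idempotent of an ideal and the lifted idempotents\<close>

lemma zero_Quot: "\<zero>\<^bsub>R Quot I\<^esub> = I"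
  by (simp add: FactRing_def)

lemma (in ring) lifted_decomposition_imp:
  assumes u: "lifted_decomposition R n u"
  shows "orthogonal_idempotents R n u"
    and "simple_decomposition (semisimple_quotient R) n (\<lambda>i. residue R (u i))"
proof -
  interpret J: ideal "jacobson_radical R" R by (rule ideal_jacobson_radical)
  interpret h: ring_hom_ring R "semisimple_quotient R" "residue R"
    by (rule J.rcos_ring_hom_ring)
  show o: "orthogonal_idempotents R n u"
    using u by unfold_locales (auto simp: lifted_decomposition_def)
  interpret orthogonal_idempotents R n u by (rule o)
  have mult: "residue R (u i) \<otimes>\<^bsub>semisimple_quotient R\<^esub> residue R (u j) = residue R (u i \<otimes> u j)"
    if "i \<in> {1..n}" "j \<in> {1..n}" for i j
    using that u_closed by simp
  show "simple_decomposition (semisimple_quotient R) n (\<lambda>i. residue R (u i))"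
  proof unfold_locales
    show "idempotent (semisimple_quotient R) (residue R (u i))" if "i \<in> {1..n}" for i
      using u_idem[OF that] mult[OF that that] by (simp add: idempotent_def)
    show "residue R (u i) \<otimes>\<^bsub>semisimple_quotient R\<^esub> residue R (u j) = \<zero>\<^bsub>semisimple_quotient R\<^esub>"
      if "i \<in> {1..n}" "j \<in> {1..n}" "i \<noteq> j" for i j
      using mult[OF that(1,2)] u_orth[OF that] h.hom_zero by simp
    show "finsum (semisimple_quotient R) (\<lambda>i. residue R (u i)) {1..n} = \<one>\<^bsub>semisimple_quotient R\<^esub>"
      using h.hom_finsum_eq[of "{1..n}" u] u_closed u_sum h.hom_one by simp
    show "simple_factors (semisimple_quotient R) n (\<lambda>i. residue R (u i))"
      using u by (simp add: lifted_decomposition_def)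
  qed
qed

text \<open>Let \<open>c\<close> be the sum of the residues of the \<open>u i\<close> over the index set of \<open>\<aa>\<close>; it generates the
  image of \<open>\<aa>\<close> as a left ideal. The residue of \<open>f\<close> lies in this image, so multiplying it by the
  idempotent \<open>c\<close> from the right changes nothing; and \<open>f\<close> is a left identity of \<open>\<aa>\<close>, so the
  product is also \<open>c\<close>.\<close>

lemma (in ring) residue_ideal_index_sum:
  assumes u: "lifted_decomposition R n u" and \<aa>: "ideal \<aa> R"
    and not_sub: "\<not> \<aa> \<subseteq> jacobson_radical R"
    and f: "f \<in> \<aa>" "\<And>a. a \<in> \<aa> \<Longrightarrow> f \<otimes> a = a"
  shows "ideal_index R n u \<aa> \<subseteq> {1..n}"
    and "residue R (finsum R u (ideal_index R n u \<aa>)) = residue R f"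
proof -
  interpret J: ideal "jacobson_radical R" R by (rule ideal_jacobson_radical)
  interpret I: ideal \<aa> R by fact
  let ?Q = "semisimple_quotient R"
  interpret h: ring_hom_ring R ?Q "residue R"
    by (rule J.rcos_ring_hom_ring)
  interpret orthogonal_idempotents R n u by (rule lifted_decomposition_imp[OF u])
  interpret Q: simple_decomposition ?Q n "\<lambda>i. residue R (u i)"
    by (rule lifted_decomposition_imp[OF u])
  let ?c = "\<lambda>i. residue R (u i)"
  have \<aa>c: "a \<in> carrier R" if "a \<in> \<aa>" for a using that I.a_subset by blast
  note zero_Q = zero_Quot[of R "jacobson_radical R"]
  define B where "B = residue R ` \<aa>"
  have B: "ideal B ?Q"
  proof (rule h.S.ideal_if_left_ideal)
    show "left_ideal B ?Q"
    proof (rule h.S.left_idealI)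
      show "B \<subseteq> carrier ?Q" using \<aa>c by (auto simp: B_def)
      show "\<zero>\<^bsub>?Q\<^esub> \<in> B"
        unfolding B_def using h.hom_zero I.zero_closed by (metis imageI)
      show "a \<oplus>\<^bsub>?Q\<^esub> b \<in> B" if ab: "a \<in> B" "b \<in> B" for a b
      proof -
        obtain a' b' where ab: "a' \<in> \<aa>" "b' \<in> \<aa>" "a = residue R a'" "b = residue R b'"
          using ab by (auto simp: B_def)
        then have "a \<oplus>\<^bsub>?Q\<^esub> b = residue R (a' \<oplus> b')" using \<aa>c by simp
        then show ?thesis using ab unfolding B_def by blast
      qed
      show "x \<otimes>\<^bsub>?Q\<^esub> a \<in> B" if x: "x \<in> carrier ?Q" and "a \<in> B" for x a
      proof -
        obtain a' where a: "a' \<in> \<aa>" "a = residue R a'" using \<open>a \<in> B\<close> by (auto simp: B_def)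
        obtain x' where x': "x' \<in> carrier R" "x = residue R x'"
          using x unfolding carrier_Quot_image[symmetric] by blast
        have "x \<otimes>\<^bsub>?Q\<^esub> a = residue R (x' \<otimes> a')" using a x' \<aa>c by simp
        then show ?thesis using I.I_l_closed[OF a(1) x'(1)] unfolding B_def by blast
      qed
    qed
    show "a \<otimes>\<^bsub>?Q\<^esub> x \<in> B" if "a \<in> B" and x: "x \<in> carrier ?Q" for x a
    proof -
      obtain a' where a: "a' \<in> \<aa>" "a = residue R a'" using \<open>a \<in> B\<close> by (auto simp: B_def)
      obtain x' where x': "x' \<in> carrier R" "x = residue R x'"
        using x unfolding carrier_Quot_image[symmetric] by blast
      have "a \<otimes>\<^bsub>?Q\<^esub> x = residue R (a' \<otimes> x')" using a x' \<aa>c by simp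
      then show ?thesis using I.I_r_closed[OF a(1) x'(1)] unfolding B_def by blast
    qed
  qed
  define K where "K = {i \<in> {1..n}. ?c i \<in> B}"
  have K: "K \<subseteq> {1..n}" by (auto simp: K_def)
  have BK: "B = left_multiples ?Q (finsum ?Q ?c K)"
    unfolding K_def by (rule Q.ideal_eq_multiples[OF B])
  have "K \<noteq> {}"
  proof
    assume "K = {}"
    then have "B \<subseteq> {\<zero>\<^bsub>?Q\<^esub>}"
      using BK by (auto simp: left_multiples_def)
    have "a \<in> jacobson_radical R" if a: "a \<in> \<aa>" for a
    proof (rule J.rcos_const_imp_mem[OF \<aa>c[OF a]])
      have "residue R a \<in> B"
        unfolding B_def using a by (rule imageI)
      then have "residue R a = \<zero>\<^bsub>?Q\<^esub>"
        using \<open>B \<subseteq> {\<zero>\<^bsub>?Q\<^esub>}\<close> by blast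
      then show "residue R a = jacobson_radical R"
        unfolding zero_Q .
    qed
    then have "\<aa> \<subseteq> jacobson_radical R"
      by (rule subsetI)
    then show False using not_sub by simp
  qed
  have img: "residue R ` (\<aa> <+>\<^bsub>R\<^esub> jacobson_radical R) = B"
  proof -
    have sum: "residue R (a \<oplus> j) = residue R a" if "a \<in> \<aa>" "j \<in> jacobson_radical R" for a j
    proof -
      have "residue R j = \<zero>\<^bsub>?Q\<^esub>"
        using J.a_rcos_const[OF that(2)] unfolding zero_Q .
      then show ?thesis using that \<aa>c J.a_subset by (auto simp: subset_iff)
    qed
    show ?thesis
    proof (intro equalityI subsetI)
      fix X assume "X \<in> residue R ` (\<aa> <+>\<^bsub>R\<^esub> jacobson_radical R)"
      then obtain a j where aj: "a \<in> \<aa>" "j \<in> jacobson_radical R" "X = residue R (a \<oplus> j)"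
        unfolding set_add_def' by blast
      then show "X \<in> B"
        unfolding B_def using sum[OF aj(1,2)] by blast
    next
      fix X assume "X \<in> B"
      then obtain a where a: "a \<in> \<aa>" "X = residue R a"
        unfolding B_def by blast
      have "a = a \<oplus> \<zero>" using \<aa>c[OF a(1)] by simp
      then have "a \<in> \<aa> <+>\<^bsub>R\<^esub> jacobson_radical R"
        using a(1) J.zero_closed unfolding set_add_def' by blast
      then show "X \<in> residue R ` (\<aa> <+>\<^bsub>R\<^esub> jacobson_radical R)"
        using a(2) by blast
    qed
  qed
  have index: "ideal_index R n u \<aa> = K"
    unfolding ideal_index_def img
  proof (rule the_equality)
    show "K \<subseteq> {1..n} \<and> K \<noteq> {} \<and> B = left_multiples ?Q (finsum ?Q ?c K)"
      using K \<open>K \<noteq> {}\<close> BK by blast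
    fix L assume "L \<subseteq> {1..n} \<and> L \<noteq> {} \<and> B = left_multiples ?Q (finsum ?Q ?c L)"
    then show "L = K"
      using Q.subset_if_multiples_subset[of L K] Q.subset_if_multiples_subset[of K L] K BK
      by blast
  qed
  then show "ideal_index R n u \<aa> \<subseteq> {1..n}" using K by simp
  let ?cK = "finsum ?Q ?c K"
  note cKc = Q.sum_closed[OF K]
  have cK_idem: "?cK \<otimes>\<^bsub>?Q\<^esub> ?cK = ?cK"
    using Q.idempotent_sum[OF K] by (simp add: idempotent_def)
  have "residue R f \<in> B" using f(1) by (simp add: B_def)
  then obtain q where q: "q \<in> carrier ?Q" "residue R f = q \<otimes>\<^bsub>?Q\<^esub> ?cK"
    unfolding BK left_multiples_def by blast
  have right: "residue R f \<otimes>\<^bsub>?Q\<^esub> ?cK = residue R f"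
    unfolding q(2) using q(1) cKc cK_idem by (simp add: h.S.m_assoc)
  have "?cK = \<one>\<^bsub>?Q\<^esub> \<otimes>\<^bsub>?Q\<^esub> ?cK" using cKc by simp
  then have "?cK \<in> B"
    unfolding BK left_multiples_def by blast
  then obtain a where a: "a \<in> \<aa>" "?cK = residue R a"
    unfolding B_def by blast
  have "residue R f \<otimes>\<^bsub>?Q\<^esub> residue R a = residue R (f \<otimes> a)"
    using \<aa>c a(1) f(1) by simp
  then have left: "residue R f \<otimes>\<^bsub>?Q\<^esub> ?cK = ?cK"
    using f(2)[OF a(1)] a(2) by simp
  have "residue R (finsum R u K) = ?cK"
    using K finite_subset[OF K] u_closed by (intro h.hom_finsum_eq) auto
  then show "residue R (finsum R u (ideal_index R n u \<aa>)) = residue R f"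
    using index left right by simp
qed

text \<open>If \<open>g = v f v\<^sup>-\<^sup>1\<close> and \<open>g R\<close> is a two-sided ideal then \<open>f R = v\<^sup>-\<^sup>1 g R = g R\<close>.\<close>

lemma (in ring) ideal_right_multiples_conjugate:
  assumes \<aa>: "ideal \<aa> R" and g: "g \<in> \<aa>" "\<And>a. a \<in> \<aa> \<Longrightarrow> g \<otimes> a = a"
    and f: "f \<in> carrier R" and v: "v \<in> Units R" "g = v \<otimes> f \<otimes> inv v"
  shows "\<aa> = right_multiples R f"
proof
  interpret I: ideal \<aa> R by fact
  have c: "g \<in> carrier R" "v \<in> carrier R" "inv v \<in> carrier R"
    using g(1) v(1) I.a_subset by auto
  have "inv v \<otimes> g \<otimes> v = inv v \<otimes> v \<otimes> f \<otimes> (inv v \<otimes> v)"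
    unfolding v(2) using c f by (simp only: m_assoc m_closed)
  then have f_eq: "f = inv v \<otimes> g \<otimes> v"
    using v(1) f by simp
  have "f \<in> \<aa>"
    unfolding f_eq using g(1) c I.I_l_closed I.I_r_closed by simp
  then show "right_multiples R f \<subseteq> \<aa>"
    using I.I_r_closed by (auto simp: right_multiples_def)
  show "\<aa> \<subseteq> right_multiples R f"
  proof
    fix a assume a: "a \<in> \<aa>"
    then have ac: "a \<in> carrier R" using I.a_subset by blast
    have "f \<otimes> a = inv v \<otimes> (g \<otimes> (v \<otimes> a))"
      unfolding f_eq using c ac by (simp only: m_assoc m_closed)
    also have "\<dots> = inv v \<otimes> (v \<otimes> a)"
      using g(2) I.I_l_closed[OF a c(2)] by simp
    also have "\<dots> = inv v \<otimes> v \<otimes> a"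
      using c ac by (simp only: m_assoc)
    also have "\<dots> = a"
      using v(1) ac by simp
    finally show "a \<in> right_multiples R f"
      using ac unfolding right_multiples_def by force
  qed
qed

section \<open>The shape of a localizing idempotent\<close>

locale idempotent_denominator_set = denominator_set R "{\<one>\<^bsub>R\<^esub>, e}" \<aa> for R (structure) and e \<aa> +
  assumes e_idem: "idempotent R e"
begin

lemma e_closed: "e \<in> carrier R" and ee: "e \<otimes> e = e"
  using e_idem by (auto simp: idempotent_def)

lemma ideal_eq_annihilated: "\<aa> = {r \<in> carrier R. e \<otimes> r = \<zero>}"
proof -
  have "e \<otimes> r = \<zero>" if "r \<in> carrier R" "\<one> \<otimes> r = \<zero>" for r
    using that e_closed by simp
  then show ?thesis using mem_ass_iff by blast
qed

lemma complement_mem: "\<one> \<ominus> e \<in> \<aa>"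
  unfolding ideal_eq_annihilated
  using e_closed ee by (simp add: a_minus_def r_distr r_minus r_neg)

lemma complement_mult:
  assumes "a \<in> \<aa>"
  shows "(\<one> \<ominus> e) \<otimes> a = a"
  using assms e_closed unfolding ideal_eq_annihilated
  by (auto simp: a_minus_def l_distr l_minus)

lemma ideal_eq_right_multiples: "\<aa> = right_multiples R (\<one> \<ominus> e)"
proof
  interpret I: ideal \<aa> R by (rule ideal_ass)
  show "\<aa> \<subseteq> right_multiples R (\<one> \<ominus> e)"
    using complement_mult I.a_subset unfolding right_multiples_def by force
  show "right_multiples R (\<one> \<ominus> e) \<subseteq> \<aa>"
    using I.I_r_closed[OF complement_mem] by (auto simp: right_multiples_def)
qed

text \<open>The ideal \<open>\<aa>\<close> is two-sided, so \<open>x (1 - e)\<close> belongs to it and is annihilated by \<open>e\<close>.\<close>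

lemma upper_corner_zero:
  assumes "x \<in> carrier R"
  shows "e \<otimes> x \<otimes> (\<one> \<ominus> e) = \<zero>"
proof -
  interpret I: ideal \<aa> R by (rule ideal_ass)
  have "x \<otimes> (\<one> \<ominus> e) \<in> \<aa>"
    using I.I_l_closed[OF complement_mem assms] .
  then show ?thesis
    using assms e_closed unfolding ideal_eq_annihilated by (simp add: m_assoc)
qed

lemma e_mult_eq_corner:
  assumes x: "x \<in> carrier R"
  shows "e \<otimes> x = e \<otimes> x \<otimes> e"
proof -
  have "e \<otimes> x \<otimes> (\<one> \<ominus> e) = e \<otimes> x \<ominus> e \<otimes> x \<otimes> e"
    using x e_closed by (simp add: a_minus_def r_distr r_minus)
  then show ?thesis
    using upper_corner_zero[OF x] x e_closed minus_eq_zero_iff[of "e \<otimes> x" "e \<otimes> x \<otimes> e"] by simp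
qed

lemma e_eq_one_if_zero_ideal:
  assumes "\<aa> = {\<zero>}"
  shows "e = \<one>"
  using complement_mem assms e_closed minus_eq_zero_iff[of \<one> e] by simp

text \<open>If \<open>\<aa>\<close> were contained in the radical, \<open>e\<close> would be congruent to \<open>1\<close> modulo the radical,
  hence a unit, and the only idempotent unit is \<open>1\<close>.\<close>

lemma ideal_not_subset_radical:
  assumes nz: "\<aa> \<noteq> {\<zero>}"
  shows "\<not> \<aa> \<subseteq> jacobson_radical R"
proof
  interpret J: ideal "jacobson_radical R" R by (rule ideal_jacobson_radical)
  interpret I: ideal \<aa> R by (rule ideal_ass)
  assume "\<aa> \<subseteq> jacobson_radical R"
  then have "\<ominus> (\<one> \<ominus> e) \<in> jacobson_radical R"
    using complement_mem J.a_inv_closed by blast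
  moreover have "\<ominus> (\<one> \<ominus> e) = e \<ominus> \<one>"
    using e_closed by (simp add: a_minus_def minus_add a_comm)
  ultimately have "e \<in> Units R"
    using unit_if_cong_one e_closed by simp
  then have "a = \<zero>" if "a \<in> \<aa>" for a
    using that Units_l_cancel[of e a \<zero>] e_closed unfolding ideal_eq_annihilated by simp
  then show False using nz I.zero_closed by blast
qed

text \<open>The complements of \<open>e\<close> and of \<open>1\<^sub>C\<^sub>I\<close> have the same residue, so \<open>e\<close> and \<open>1\<^sub>C\<^sub>I\<close> are
  conjugate idempotents; conjugating \<open>1 - e\<close> back leaves the two-sided ideal \<open>\<aa> = (1 - e) R\<close>
  unchanged.\<close>

lemma lifted_idempotents:
  assumes nz: "\<aa> \<noteq> {\<zero>}" and u: "lifted_decomposition R n u"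
  shows "\<aa> = right_multiples R (finsum R u (ideal_index R n u \<aa>))"
    and "finsum R u (ideal_coindex R n u \<aa>) = \<one> \<ominus> finsum R u (ideal_index R n u \<aa>)"
    and "conjugate R e (finsum R u (ideal_coindex R n u \<aa>))"
proof -
  interpret J: ideal "jacobson_radical R" R by (rule ideal_jacobson_radical)
  interpret h: ring_hom_ring R "semisimple_quotient R" "residue R"
    by (rule J.rcos_ring_hom_ring)
  interpret orthogonal_idempotents R n u by (rule lifted_decomposition_imp[OF u])
  note index = residue_ideal_index_sum[OF u ideal_ass ideal_not_subset_radical[OF nz]
      complement_mem complement_mult]
  let ?I = "ideal_index R n u \<aa>"
  let ?f = "finsum R u ?I"
  have f: "?f \<in> carrier R" using sum_closed[OF index(1)] .
  show co: "finsum R u (ideal_coindex R n u \<aa>) = \<one> \<ominus> ?f"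
    unfolding ideal_coindex_def by (rule sum_complement[OF index(1)])
  have idem: "idempotent R (\<one> \<ominus> ?f)"
    unfolding co[symmetric] ideal_coindex_def by (rule idempotent_sum) blast
  have e_eq: "e = \<one> \<ominus> (\<one> \<ominus> e)"
    using e_closed by (simp add: a_minus_def minus_add r_neg1 flip: a_assoc) (simp add: r_neg)
  have "residue R (\<one> \<ominus> (\<one> \<ominus> e)) = residue R (\<one> \<ominus> ?f)"
    using f e_closed index(2) by (simp only: a_minus_def h.hom_add h.hom_a_inv a_inv_closed one_closed a_closed)
  then have "residue R e = residue R (\<one> \<ominus> ?f)"
    using e_eq by simp
  then have "conjugate R e (\<one> \<ominus> ?f)"
    by (rule conjugate_if_idempotents_cong[OF e_idem idem])
  then show "conjugate R e (finsum R u (ideal_coindex R n u \<aa>))"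
    using co by simp
  obtain v where v: "v \<in> Units R" "e = v \<otimes> (\<one> \<ominus> ?f) \<otimes> inv v"
    using \<open>conjugate R e (\<one> \<ominus> ?f)\<close> by (auto simp: conjugate_def)
  have vc: "v \<in> carrier R" "inv v \<in> carrier R" using v(1) by auto
  have "\<one> \<ominus> e = \<one> \<ominus> (v \<otimes> inv v \<ominus> v \<otimes> ?f \<otimes> inv v)"
    unfolding v(2) using vc f by (simp add: a_minus_def r_distr l_distr r_minus l_minus)
  also have "\<dots> = v \<otimes> ?f \<otimes> inv v"
    using v(1) vc f by (simp add: a_minus_def minus_add r_neg flip: a_assoc)
  finally show "\<aa> = right_multiples R ?f"
    by (intro ideal_right_multiples_conjugate[OF ideal_ass complement_mem complement_mult f v(1)])
qed

lemma mem_ideal_iff_corner_zero: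
  assumes "x \<in> carrier R"
  shows "x \<in> \<aa> \<longleftrightarrow> e \<otimes> x \<otimes> e = \<zero>"
  using assms e_mult_eq_corner[OF assms] unfolding ideal_eq_annihilated by simp

text \<open>An inverse \<open>r\<close> of \<open>s\<close> modulo \<open>\<aa>\<close> gives the inverse \<open>e r e\<close> of \<open>e s e\<close>, since \<open>x \<mapsto> e x e\<close>
  is multiplicative and kills \<open>\<aa>\<close>.\<close>

lemma corner_unit:
  assumes R: "left_artinian_ring R" and S: "S \<in> Den_l R \<aa>" and s: "s \<in> S"
  shows "e \<otimes> s \<otimes> e \<in> Units (corner_ring R e)"
proof -
  interpret S: denominator_set R S \<aa> by unfold_locales fact
  interpret I: ideal \<aa> R by (rule ideal_ass)
  interpret h: ring_hom_ring R "R Quot \<aa>" "(+>) \<aa>" by (rule I.rcos_ring_hom_ring)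
  have sc: "s \<in> carrier R" using S.S_closed[OF s] .
  obtain X where X: "X \<in> carrier (R Quot \<aa>)" "X \<otimes>\<^bsub>R Quot \<aa>\<^esub> (\<aa> +> s) = \<one>\<^bsub>R Quot \<aa>\<^esub>"
    "(\<aa> +> s) \<otimes>\<^bsub>R Quot \<aa>\<^esub> X = \<one>\<^bsub>R Quot \<aa>\<^esub>"
    using S.unit_mod_ass[OF R s] unfolding Units_def by blast
  obtain r where r: "r \<in> carrier R" "X = \<aa> +> r"
    using X(1) unfolding carrier_Quot_image[symmetric] by blast
  have corner_mult: "(e \<otimes> x \<otimes> e) \<otimes> (e \<otimes> y \<otimes> e) = e \<otimes> (x \<otimes> y) \<otimes> e"
    if x: "x \<in> carrier R" and y: "y \<in> carrier R" for x y
  proof -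
    have "(e \<otimes> x \<otimes> e) \<otimes> (e \<otimes> y \<otimes> e) = (e \<otimes> x \<otimes> e) \<otimes> (e \<otimes> y)"
      using e_mult_eq_corner[OF y] by simp
    also have "\<dots> = (e \<otimes> x) \<otimes> (e \<otimes> y)"
      using e_mult_eq_corner[OF x] by simp
    also have "\<dots> = (e \<otimes> x \<otimes> e) \<otimes> y"
      using x y e_closed by (simp add: m_assoc)
    also have "\<dots> = (e \<otimes> x) \<otimes> y"
      using e_mult_eq_corner[OF x] by simp
    also have "\<dots> = e \<otimes> (x \<otimes> y)"
      using x y e_closed by (simp add: m_assoc)
    also have "\<dots> = e \<otimes> (x \<otimes> y) \<otimes> e"
      using x y by (intro e_mult_eq_corner) simp
    finally show ?thesis .
  qed
  have corner_one: "e \<otimes> x \<otimes> e = e" if x: "x \<in> carrier R" and "\<aa> +> x = \<one>\<^bsub>R Quot \<aa>\<^esub>" for x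
  proof -
    have "\<aa> +> x = \<aa> +> \<one>" using that h.hom_one by simp
    then have "x \<ominus> \<one> \<in> \<aa>"
      using quotient_eq_iff_same_a_r_cos[OF ideal_ass x one_closed] by blast
    then have "e \<otimes> (x \<ominus> \<one>) = \<zero>"
      unfolding ideal_eq_annihilated by blast
    then have "e \<otimes> x \<ominus> e = \<zero>"
      using x e_closed by (simp add: a_minus_def r_distr r_minus)
    then have "e \<otimes> x = e"
      using x e_closed minus_eq_zero_iff[of "e \<otimes> x" e] by simp
    then show ?thesis using ee by simp
  qed
  have "e \<otimes> (r \<otimes> s) \<otimes> e = e" "e \<otimes> (s \<otimes> r) \<otimes> e = e"
    using corner_one[of "r \<otimes> s"] corner_one[of "s \<otimes> r"] X(2,3)[unfolded r(2)] r(1) sc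
    by simp_all
  then have "(e \<otimes> r \<otimes> e) \<otimes> (e \<otimes> s \<otimes> e) = e" "(e \<otimes> s \<otimes> e) \<otimes> (e \<otimes> r \<otimes> e) = e"
    using corner_mult r(1) sc by simp_all
  moreover have "e \<otimes> s \<otimes> e \<in> peirce R e e" "e \<otimes> r \<otimes> e \<in> peirce R e e"
    using r(1) sc unfolding peirce_def by blast+
  ultimately show ?thesis
    by (auto simp: Units_def corner_ring_def)
qed

end

theorem theorem4p5:
  fixes R :: "('a, 'm) ring_scheme" (structure)
    and S \<aa> :: "'a set"
  assumes "left_artinian_ring R"
    and "S \<in> Den_l R \<aa>"
  shows "(\<exists>e. localizing_idempotent R S \<aa> e) \<and>
    (\<forall>e. localizing_idempotent R S \<aa> e \<longrightarrow>
       (\<aa> = {\<zero>} \<longrightarrow> e = \<one>) \<and>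
       (\<aa> \<noteq> {\<zero>} \<longrightarrow>
          \<aa> = right_multiples R (\<one> \<ominus> e) \<and>
          \<not> \<aa> \<subseteq> jacobson_radical R \<and>
          (\<forall>n u. lifted_decomposition R n u \<longrightarrow>
             \<aa> = right_multiples R (finsum R u (ideal_index R n u \<aa>)) \<and>
             finsum R u (ideal_coindex R n u \<aa>) = \<one> \<ominus> finsum R u (ideal_index R n u \<aa>) \<and>
             conjugate R e (finsum R u (ideal_coindex R n u \<aa>)))) \<and>
       (let R11 = peirce R e e; R12 = peirce R e (\<one> \<ominus> e);
            R21 = peirce R (\<one> \<ominus> e) e; R22 = peirce R (\<one> \<ominus> e) (\<one> \<ominus> e)
        in R12 = {\<zero>} \<and>
           carrier R = matrix_set R e R11 {\<zero>} R21 R22 \<and>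
           \<aa> = matrix_set R e {\<zero>} {\<zero>} R21 R22 \<and>
           S \<subseteq> matrix_set R e (Units (corner_ring R e)) {\<zero>} R21 R22))"
proof (rule conjI, rule exists_localizing_idempotent[OF assms], rule allI, rule impI)
  interpret ring R using assms(1) by (simp add: left_artinian_ring_def)
  fix e assume e: "localizing_idempotent R S \<aa> e"
  interpret idempotent_denominator_set R e \<aa>
    using e by unfold_locales (auto simp: localizing_idempotent_def)
  let ?d = "\<one> \<ominus> e"
  have peirce_mem: "a \<otimes> x \<otimes> b \<in> peirce R a b" if "x \<in> carrier R" for a x b
    using that unfolding peirce_def by blast
  have \<aa>_sub: "\<aa> \<subseteq> carrier R" using mem_ass_iff by blast
  have S_sub: "S \<subseteq> carrier R"
    using denominator_set.S_closed[of R S \<aa>] assms(2) ring_axioms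
    by (auto simp: denominator_set_def denominator_set_axioms_def)
  have "peirce R e ?d = {\<zero>}"
    using upper_corner_zero unfolding peirce_def by (auto intro!: exI[of _ \<zero>] simp: e_closed)
  moreover have "carrier R = matrix_set R e (peirce R e e) {\<zero>} (peirce R ?d e) (peirce R ?d ?d)"
    using upper_corner_zero peirce_mem by (auto simp: matrix_set_def Let_def)
  moreover have "\<aa> = matrix_set R e {\<zero>} {\<zero>} (peirce R ?d e) (peirce R ?d ?d)"
    using upper_corner_zero peirce_mem mem_ideal_iff_corner_zero \<aa>_sub
    by (auto simp: matrix_set_def Let_def subset_iff)
  moreover have "S \<subseteq> matrix_set R e (Units (corner_ring R e)) {\<zero>} (peirce R ?d e) (peirce R ?d ?d)"
    using upper_corner_zero peirce_mem corner_unit[OF assms] S_sub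
    by (auto simp: matrix_set_def Let_def subset_iff)
  ultimately show "(\<aa> = {\<zero>} \<longrightarrow> e = \<one>) \<and>
       (\<aa> \<noteq> {\<zero>} \<longrightarrow>
          \<aa> = right_multiples R ?d \<and>
          \<not> \<aa> \<subseteq> jacobson_radical R \<and>
          (\<forall>n u. lifted_decomposition R n u \<longrightarrow>
             \<aa> = right_multiples R (finsum R u (ideal_index R n u \<aa>)) \<and>
             finsum R u (ideal_coindex R n u \<aa>) = \<one> \<ominus> finsum R u (ideal_index R n u \<aa>) \<and>
             conjugate R e (finsum R u (ideal_coindex R n u \<aa>)))) \<and>
       (let R11 = peirce R e e; R12 = peirce R e ?d;
            R21 = peirce R ?d e; R22 = peirce R ?d ?d
        in R12 = {\<zero>} \<and>
           carrier R = matrix_set R e R11 {\<zero>} R21 R22 \<and>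
           \<aa> = matrix_set R e {\<zero>} {\<zero>} R21 R22 \<and>
           S \<subseteq> matrix_set R e (Units (corner_ring R e)) {\<zero>} R21 R22)"
    unfolding Let_def
    using e_eq_one_if_zero_ideal ideal_eq_right_multiples ideal_not_subset_radical
      lifted_idempotents by blast
qed

end
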